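(* Let $\omega=e^{2\pi i/3}$. An Eisenstein integer $\alpha\in\mathbb{Z}[\omega]$ is an even primitive norm-perfect number if and only if either (1) $\alpha=\varepsilon(1-\omega^2)^{k-1}\big[(1-\omega^2)^k-1\big]$, where $(1-\omega^2)^k-1$ is prime in $\mathbb{Z}[\omega]$ and $k$ is a rational prime with $k\equiv 1 \pmod{12}$, or (2) $\alpha=\varepsilon(1-\omega^2)^{k-1}\overline{\big[(1-\omega^2)^k-1\big]}$, where $(1-\omega^2)^k-1$ is prime in $\mathbb{Z}[\omega]$ and $k$ is a rational prime with $k\equiv -1 \pmod{12}$, and $\varepsilon$ is a unit of $\mathbb{Z}[\omega]$. Moreover, the even primitive perfect Eisenstein integers are exactly the $\alpha$ of form (1) with $\varepsilon=-\omega$.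
   Context: $\mathbb{Z}[\omega]$ is a UFD with norm $N(a+b\omega)=a^2-ab+b^2$. The positive primes are $\mathbb{P}^+=\{a+b\omega\in\mathbb{Z}[\omega]: a>b\ge 0\}\cap\{\text{primes of }\mathbb{Z}[\omega]\}$; every prime has exactly one positive associate, and $1-\omega^2=2+\omega$ is positive. For nonzero $\alpha=\varepsilon\prod_{j=1}^l\pi_j^{e_j}$ with $\varepsilon$ a unit and distinct $\pi_j\in\mathbb{P}^+$, define $\sigma(\alpha)=\prod_{j=1}^l\frac{\pi_j^{e_j+1}-1}{\pi_j-1}$ (so $\sigma(\varepsilon)=1$). $\alpha$ is even if $(1-\omega^2)\mid\alpha$, odd otherwise. $\alpha$ is perfect if $\sigma(\alpha)=(1-\omega^2)\alpha$ and norm-perfect if $N(\sigma(\alpha))=3N(\alpha)$. A (norm-)perfect $\alpha$ is primitive if there is no (norm-)perfect $\beta\in\mathbb{Z}[\omega]$ with $\beta\mid\alpha$ and $\beta$ not associate to $\alpha$. The bar denotes complex conjugation. *)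

theory Defs
  imports
    Complex_Main
    "HOL-Number_Theory.Cong"
    "HOL-Computational_Algebra.Factorial_Ring"
    "HOL-Computational_Algebra.Euclidean_Algorithm"
begin

section \<open>The Eisenstein integers as a subring of the complex numbers\<close>

definition eis_set :: "complex set" where
  "eis_set = {of_int a + of_int b * cis (2 * pi / 3) | a b. True}"

lemma eis_setI: "z = of_int a + of_int b * cis (2 * pi / 3) \<Longrightarrow> z \<in> eis_set"
  unfolding eis_set_def by blast

lemma eis_setE:
  assumes "z \<in> eis_set"
  obtains a b where "z = of_int a + of_int b * cis (2 * pi / 3)"
  using assms unfolding eis_set_def by blast

lemma cis_third_square: "cis (2 * pi / 3) * cis (2 * pi / 3) = - 1 - cis (2 * pi / 3)"
  by (simp add: complex_eq_iff cos_120 sin_120)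

typedef eisenstein = eis_set
  morphisms complex_of_eis Abs_eis
  unfolding eis_set_def by blast

setup_lifting type_definition_eisenstein

instantiation eisenstein :: idom
begin

lift_definition zero_eisenstein :: eisenstein is 0
  by (rule eis_setI[of _ 0 0]) simp

lift_definition one_eisenstein :: eisenstein is 1
  by (rule eis_setI[of _ 1 0]) simp

lift_definition plus_eisenstein :: "eisenstein \<Rightarrow> eisenstein \<Rightarrow> eisenstein" is "(+)"
proof -
  fix x y assume "x \<in> eis_set" "y \<in> eis_set"
  then obtain a b c d where "x = of_int a + of_int b * cis (2 * pi / 3)"
    and "y = of_int c + of_int d * cis (2 * pi / 3)" by (elim eis_setE)
  then have "x + y = of_int (a + c) + of_int (b + d) * cis (2 * pi / 3)"
    by (simp add: algebra_simps)
  then show "x + y \<in> eis_set" by (rule eis_setI)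
qed

lift_definition uminus_eisenstein :: "eisenstein \<Rightarrow> eisenstein" is uminus
proof -
  fix x assume "x \<in> eis_set"
  then obtain a b where "x = of_int a + of_int b * cis (2 * pi / 3)" by (rule eis_setE)
  then have "- x = of_int (- a) + of_int (- b) * cis (2 * pi / 3)" by simp
  then show "- x \<in> eis_set" by (rule eis_setI)
qed

lift_definition minus_eisenstein :: "eisenstein \<Rightarrow> eisenstein \<Rightarrow> eisenstein" is "(-)"
proof -
  fix x y assume "x \<in> eis_set" "y \<in> eis_set"
  then obtain a b c d where "x = of_int a + of_int b * cis (2 * pi / 3)"
    and "y = of_int c + of_int d * cis (2 * pi / 3)" by (elim eis_setE)
  then have "x - y = of_int (a - c) + of_int (b - d) * cis (2 * pi / 3)"
    by (simp add: algebra_simps)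
  then show "x - y \<in> eis_set" by (rule eis_setI)
qed

lift_definition times_eisenstein :: "eisenstein \<Rightarrow> eisenstein \<Rightarrow> eisenstein" is "(*)"
proof -
  fix x y assume "x \<in> eis_set" "y \<in> eis_set"
  then obtain a b c d where x: "x = of_int a + of_int b * cis (2 * pi / 3)"
    and y: "y = of_int c + of_int d * cis (2 * pi / 3)" by (elim eis_setE)
  have "x * y = of_int a * of_int c
      + (of_int a * of_int d + of_int b * of_int c) * cis (2 * pi / 3)
      + of_int b * of_int d * (cis (2 * pi / 3) * cis (2 * pi / 3))"
    unfolding x y by (simp only: algebra_simps)
  also have "\<dots> = of_int (a * c - b * d) + of_int (a * d + b * c - b * d) * cis (2 * pi / 3)"
    unfolding cis_third_square
    by (simp add: ring_distribs mult_ac)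
  finally show "x * y \<in> eis_set" by (rule eis_setI)
qed

instance
proof
  fix a b c :: eisenstein
  show "a * b * c = a * (b * c)" by transfer simp
  show "a * b = b * a" by transfer simp
  show "a + b + c = a + (b + c)" by transfer simp
  show "a + b = b + a" by transfer simp
  show "0 + a = a" by transfer simp
  show "- a + a = 0" by transfer simp
  show "a - b = a + - b" by transfer simp
  show "1 * a = a" by transfer simp
  show "(a + b) * c = a * c + b * c" by transfer (rule distrib_right)
  show "a * (b + c) = a * b + a * c" by transfer (rule distrib_left)
  show "0 * a = 0" by transfer simp
  show "a * 0 = 0" by transfer simp
  show "(0 :: eisenstein) \<noteq> 1" by transfer simp
  show "a * b \<noteq> 0" if "a \<noteq> 0" and "b \<noteq> 0" using that by transfer simp
qed

end

lift_definition eis_omega :: eisenstein (\<open>\<omega>\<close>) is "cis (2 * pi / 3)"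
  by (rule eis_setI[of _ 0 1]) simp

lift_definition eis_cnj :: "eisenstein \<Rightarrow> eisenstein" is cnj
proof -
  fix x assume "x \<in> eis_set"
  then obtain a b where x: "x = of_int a + of_int b * cis (2 * pi / 3)" by (rule eis_setE)
  have "cnj x = of_int (a - b) + of_int (- b) * cis (2 * pi / 3)"
    unfolding x by (simp add: complex_eq_iff cos_120 sin_120)
  then show "cnj x \<in> eis_set" by (rule eis_setI)
qed

lemma complex_of_eis_of_int: "complex_of_eis (of_int a) = of_int a"
proof -
  have nat: "complex_of_eis (of_nat n) = of_nat n" for n
    by (induction n) (simp_all add: zero_eisenstein.rep_eq one_eisenstein.rep_eq plus_eisenstein.rep_eq)
  show ?thesis
    by (cases a rule: int_diff_cases) (simp add: nat minus_eisenstein.rep_eq)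
qed

lemma complex_of_eis_coords:
  "complex_of_eis (of_int a + of_int b * \<omega>) = of_int a + of_int b * cis (2 * pi / 3)"
  by (simp add: complex_of_eis_of_int plus_eisenstein.rep_eq times_eisenstein.rep_eq
      eis_omega.rep_eq)

lemma eis_coords_exist:
  obtains a b where "x = of_int a + of_int b * \<omega>"
proof -
  obtain a b where "complex_of_eis x = of_int a + of_int b * cis (2 * pi / 3)"
    using complex_of_eis[of x] by (rule eis_setE)
  then have "x = of_int a + of_int b * \<omega>"
    by (simp add: complex_of_eis_inject[symmetric] complex_of_eis_coords)
  then show ?thesis by (rule that)
qed

lemma eis_coords_unique:
  "of_int a + of_int b * \<omega> = of_int c + of_int d * \<omega> \<longleftrightarrow> a = c \<and> b = d"
  by (auto simp: complex_of_eis_inject[symmetric] complex_of_eis_coords complex_eq_iff sin_120)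

lemma omega_square: "\<omega> * \<omega> = - 1 - \<omega>"
  by transfer (rule cis_third_square)

lemma omega_mult_coords:
  "\<omega> * (of_int a + of_int b * \<omega>) = of_int (- b) + of_int (a - b) * \<omega>"
proof -
  have "\<omega> * (of_int a + of_int b * \<omega>) = of_int a * \<omega> + of_int b * (\<omega> * \<omega>)"
    by (simp add: algebra_simps)
  then show ?thesis by (simp add: omega_square algebra_simps)
qed

definition eis_norm :: "eisenstein \<Rightarrow> int" where
  "eis_norm x = (THE n. \<exists>a b. x = of_int a + of_int b * \<omega> \<and> n = a^2 - a * b + b^2)"

lemma eis_norm_coords: "eis_norm (of_int a + of_int b * \<omega>) = a^2 - a * b + b^2"
  unfolding eis_norm_def eis_coords_unique by (rule the_equality) auto

lemma cmod_coords: "(cmod (of_real s + of_real t * cis (2 * pi / 3)))^2 = s^2 - s * t + t^2"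
proof -
  have re_im: "Re (of_real s + of_real t * cis (2 * pi / 3)) = s - t / 2"
    "Im (of_real s + of_real t * cis (2 * pi / 3)) = t * sqrt 3 / 2"
    by (simp_all add: cos_120 sin_120)
  show ?thesis
    unfolding cmod_power2 re_im by (simp add: power2_eq_square field_simps)
qed

lemma eis_norm_cmod: "real_of_int (eis_norm x) = (cmod (complex_of_eis x))^2"
proof -
  obtain a b where x: "x = of_int a + of_int b * \<omega>" by (rule eis_coords_exist)
  show ?thesis
    unfolding x eis_norm_coords complex_of_eis_coords
    using cmod_coords[of "of_int a" "of_int b"] by simp
qed

lemma eis_norm_mult: "eis_norm (x * y) = eis_norm x * eis_norm y"
proof -
  have "real_of_int (eis_norm (x * y)) = real_of_int (eis_norm x * eis_norm y)"
    by (simp add: eis_norm_cmod times_eisenstein.rep_eq norm_mult power_mult_distrib)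
  then show ?thesis by (simp only: of_int_eq_iff)
qed

lemma eis_norm_nonneg: "eis_norm x \<ge> 0"
  using eis_norm_cmod[of x] by (metis of_int_0_le_iff zero_le_power2)

lemma eis_norm_eq_0_iff: "eis_norm x = 0 \<longleftrightarrow> x = 0"
proof -
  have "eis_norm x = 0 \<longleftrightarrow> complex_of_eis x = 0"
    unfolding of_int_eq_0_iff[where 'a = real, symmetric] eis_norm_cmod by simp
  then show ?thesis
    by (simp add: complex_of_eis_inject[symmetric] zero_eisenstein.rep_eq)
qed

lemma eis_norm_1: "eis_norm 1 = 1"
  using eis_norm_coords[of 1 0] by simp

section \<open>Euclidean division\<close>

definition coord1 :: "complex \<Rightarrow> real" where "coord1 z = Re z + Im z / sqrt 3"
definition coord2 :: "complex \<Rightarrow> real" where "coord2 z = 2 * Im z / sqrt 3"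

lemma coords_complex: "z = of_real (coord1 z) + of_real (coord2 z) * cis (2 * pi / 3)"
  by (simp add: complex_eq_iff coord1_def coord2_def cos_120 sin_120)

lemma coord_of_int:
  "coord1 (of_int a + of_int b * cis (2 * pi / 3)) = of_int a"
  "coord2 (of_int a + of_int b * cis (2 * pi / 3)) = of_int b"
  by (simp_all add: coord1_def coord2_def cos_120 sin_120)

definition eis_round :: "complex \<Rightarrow> eisenstein" where
  "eis_round z = of_int (round (coord1 z)) + of_int (round (coord2 z)) * \<omega>"

lemma eis_round_complex_of_eis: "eis_round (complex_of_eis x) = x"
proof -
  obtain a b where x: "x = of_int a + of_int b * \<omega>" by (rule eis_coords_exist)
  show ?thesis
    unfolding x complex_of_eis_coords eis_round_def coord_of_int by simp
qed

lemma eis_round_bound: "(cmod (z - complex_of_eis (eis_round z)))^2 < 1"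
proof -
  define s t where "s = coord1 z - round (coord1 z)" and "t = coord2 z - round (coord2 z)"
  have st: "\<bar>s\<bar> \<le> 1 / 2" "\<bar>t\<bar> \<le> 1 / 2"
    using of_int_round_abs_le[of "coord1 z"] of_int_round_abs_le[of "coord2 z"]
    unfolding s_def t_def by linarith+
  have "z - complex_of_eis (eis_round z) = of_real s + of_real t * cis (2 * pi / 3)"
    unfolding eis_round_def complex_of_eis_coords s_def t_def
    by (subst coords_complex[of z]) (simp add: ring_distribs)
  then have eq: "(cmod (z - complex_of_eis (eis_round z)))^2 = s^2 - s * t + t^2"
    by (simp add: cmod_coords)
  have "s^2 \<le> (1/2)^2" "t^2 \<le> (1/2)^2"
    using st by (simp_all add: abs_le_square_iff[symmetric])
  moreover have "\<bar>s * t\<bar> \<le> (1/2) * (1/2)"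
    unfolding abs_mult using st by (intro mult_mono) auto
  ultimately have "s^2 - s * t + t^2 \<le> 3 / 4" by (simp add: power2_eq_square abs_le_iff)
  then show ?thesis unfolding eq by simp
qed

instantiation eisenstein :: euclidean_ring
begin

definition divide_eisenstein :: "eisenstein \<Rightarrow> eisenstein \<Rightarrow> eisenstein" where
  "x div y = eis_round (complex_of_eis x / complex_of_eis y)"

definition modulo_eisenstein :: "eisenstein \<Rightarrow> eisenstein \<Rightarrow> eisenstein" where
  "x mod y = x - x div y * (y :: eisenstein)"

definition euclidean_size_eisenstein :: "eisenstein \<Rightarrow> nat" where
  "euclidean_size x = nat (eis_norm x)"

instance
proof
  fix a b :: eisenstein
  have nz: "complex_of_eis b \<noteq> 0" if "b \<noteq> 0"
    using that by (simp add: complex_of_eis_inject[symmetric] zero_eisenstein.rep_eq)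
  show "a div 0 = 0"
    by (simp add: divide_eisenstein_def zero_eisenstein.rep_eq eis_round_def coord1_def coord2_def)
  show "a * b div b = a" if "b \<noteq> 0"
    using nz[OF that] by (simp add: divide_eisenstein_def times_eisenstein.rep_eq eis_round_complex_of_eis)
  show "a div b * b + a mod b = a" by (simp add: modulo_eisenstein_def)
  show "euclidean_size (0 :: eisenstein) = 0"
    using eis_norm_eq_0_iff[of 0] by (simp add: euclidean_size_eisenstein_def)
  show "euclidean_size (a mod b) < euclidean_size b" if "b \<noteq> 0"
  proof -
    define z where "z = complex_of_eis a / complex_of_eis b"
    have "complex_of_eis (a mod b) = complex_of_eis b * (z - complex_of_eis (eis_round z))"
      using nz[OF that]
      by (simp add: modulo_eisenstein_def divide_eisenstein_def z_def minus_eisenstein.rep_eq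
          times_eisenstein.rep_eq algebra_simps)
    then have "real_of_int (eis_norm (a mod b))
        = (cmod (complex_of_eis b))^2 * (cmod (z - complex_of_eis (eis_round z)))^2"
      by (simp add: eis_norm_cmod norm_mult power_mult_distrib)
    also have "\<dots> < (cmod (complex_of_eis b))^2 * 1"
      by (rule mult_strict_left_mono[OF eis_round_bound]) (simp add: nz[OF that])
    finally have "eis_norm (a mod b) < eis_norm b"
      by (simp add: eis_norm_cmod[symmetric])
    then show ?thesis
      unfolding euclidean_size_eisenstein_def using eis_norm_nonneg[of "a mod b"] by linarith
  qed
  show "euclidean_size a \<le> euclidean_size (a * b)" if "b \<noteq> 0"
  proof -
    have "eis_norm b \<noteq> 0" using that by (simp add: eis_norm_eq_0_iff)
    then have "1 \<le> eis_norm b" using eis_norm_nonneg[of b] by linarith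
    then have "eis_norm a * 1 \<le> eis_norm a * eis_norm b"
      by (intro mult_left_mono eis_norm_nonneg)
    then show ?thesis
      by (simp add: euclidean_size_eisenstein_def eis_norm_mult)
  qed
qed

end

section \<open>Units and positive elements\<close>

definition eis_positive :: "eisenstein \<Rightarrow> bool" where
  "eis_positive x \<longleftrightarrow> (\<exists>a b. x = of_int a + of_int b * \<omega> \<and> a > b \<and> b \<ge> 0)"

lemma eis_positive_coords: "eis_positive (of_int a + of_int b * \<omega>) \<longleftrightarrow> a > b \<and> b \<ge> 0"
  unfolding eis_positive_def eis_coords_unique by blast

lemma eis_unit_cases:
  assumes "is_unit (u :: eisenstein)"
  shows "u \<in> {1, - 1, \<omega>, - \<omega>, \<omega> * \<omega>, - (\<omega> * \<omega>)}"
proof -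
  obtain v where "1 = u * v" using assms by (elim dvdE)
  then have "eis_norm u * eis_norm v = 1" by (metis eis_norm_1 eis_norm_mult)
  then have n: "eis_norm u = 1"
    using eis_norm_nonneg[of u] by (simp add: zmult_eq_1_iff)
  obtain a b where u: "u = of_int a + of_int b * \<omega>" by (rule eis_coords_exist)
  have q: "a^2 - a * b + b^2 = 1" using n unfolding u eis_norm_coords .
  then have "(2 * a - b)^2 + 3 * b^2 = 4" "(2 * b - a)^2 + 3 * a^2 = 4"
    by (simp_all add: power2_eq_square algebra_simps)
  then have "b^2 < 2^2" "a^2 < 2^2"
    using zero_le_power2[of "2 * a - b"] zero_le_power2[of "2 * b - a"]
    unfolding power2_eq_square[of "2 :: int"] by linarith+
  moreover have "\<bar>c\<bar> < 2" if "c^2 < 2^2" for c :: int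
    using power2_less_imp_less[of "\<bar>c\<bar>" 2] that by simp
  ultimately have "\<bar>b\<bar> < 2" "\<bar>a\<bar> < 2" by blast+
  then have "a \<in> {- 1, 0, 1}" "b \<in> {- 1, 0, 1}" by auto
  moreover have "\<not> (a = 1 \<and> b = - 1)" "\<not> (a = - 1 \<and> b = 1)" "\<not> (a = 0 \<and> b = 0)"
    using q by (auto simp: power2_eq_square)
  ultimately have "(a, b) \<in> {(1, 0), (- 1, 0), (0, 1), (0, - 1), (- 1, - 1), (1, 1)}" by auto
  then have "u = 1 \<or> u = - 1 \<or> u = \<omega> \<or> u = - \<omega> \<or> u = - 1 - \<omega> \<or> u = 1 + \<omega>"
    unfolding u by (elim insertE emptyE) simp_all
  moreover have "- (\<omega> * \<omega>) = 1 + \<omega>" by (simp add: omega_square)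
  ultimately show ?thesis using omega_square by auto
qed

lemma eis_units: "is_unit (- 1 :: eisenstein)" "is_unit \<omega>"
proof -
  show "is_unit (- 1 :: eisenstein)" by simp
  have "1 = \<omega> * (- 1 - \<omega>)" by (simp add: algebra_simps omega_square)
  then show "is_unit \<omega>" by (rule dvdI)
qed

lemma omega_mult_positive:
  assumes "eis_positive y"
  shows "\<not> eis_positive (- y)" "\<not> eis_positive (\<omega> * y)" "\<not> eis_positive (- (\<omega> * y))"
    "\<not> eis_positive (\<omega> * (\<omega> * y))" "\<not> eis_positive (- (\<omega> * (\<omega> * y)))"
proof -
  obtain a b where y: "y = of_int a + of_int b * \<omega>" by (rule eis_coords_exist)
  have ab: "a > b" "b \<ge> 0" using assms unfolding y eis_positive_coords by auto
  have neg: "- (of_int c + of_int d * \<omega>) = of_int (- c) + of_int (- d) * \<omega>" for c d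
    by simp
  show "\<not> eis_positive (- y)" "\<not> eis_positive (\<omega> * y)" "\<not> eis_positive (- (\<omega> * y))"
    "\<not> eis_positive (\<omega> * (\<omega> * y))" "\<not> eis_positive (- (\<omega> * (\<omega> * y)))"
    unfolding y omega_mult_coords neg eis_positive_coords using ab by auto
qed

lemma positive_associate_unique:
  assumes "eis_positive y" "eis_positive (u * y)" "is_unit u"
  shows "u = 1"
  using eis_unit_cases[OF assms(3)] assms(2) omega_mult_positive[OF assms(1)]
  by (auto simp: mult.assoc)

lemma positive_associate_exists:
  assumes "x \<noteq> 0"
  obtains u where "is_unit u" "eis_positive (u * x)"
proof -
  obtain a b where x: "x = of_int a + of_int b * \<omega>" by (rule eis_coords_exist)
  have "a \<noteq> 0 \<or> b \<noteq> 0" using assms unfolding x by auto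
  have neg: "- (of_int c + of_int d * \<omega>) = of_int (- c) + of_int (- d) * \<omega>" for c d
    by simp
  have "eis_positive x \<or> eis_positive (- x) \<or> eis_positive (\<omega> * x) \<or> eis_positive (- (\<omega> * x))
    \<or> eis_positive (\<omega> * (\<omega> * x)) \<or> eis_positive (- (\<omega> * (\<omega> * x)))"
    unfolding x omega_mult_coords neg eis_positive_coords using \<open>a \<noteq> 0 \<or> b \<noteq> 0\<close> by presburger
  then have "\<exists>u \<in> {1, - 1, \<omega>, - \<omega>, \<omega> * \<omega>, - (\<omega> * \<omega>)}. eis_positive (u * x)"
    by (auto simp: mult.assoc)
  moreover have "is_unit u" if "u \<in> {1, - 1, \<omega>, - \<omega>, \<omega> * \<omega>, - (\<omega> * \<omega>)}" for u
    using that eis_units by auto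
  ultimately show ?thesis using that by blast
qed

section \<open>Unique factorization\<close>

instantiation eisenstein :: normalization_euclidean_semiring
begin

definition normalize_eisenstein :: "eisenstein \<Rightarrow> eisenstein" where
  "normalize (x :: eisenstein) = (if x = 0 then 0 else THE y. eis_positive y \<and> (\<exists>u. is_unit u \<and> x = u * y))"

definition unit_factor_eisenstein :: "eisenstein \<Rightarrow> eisenstein" where
  "unit_factor x = (if x = 0 then 0 else THE u. is_unit u \<and> (\<exists>y. eis_positive y \<and> x = u * y))"

lemma eis_decomposition:
  assumes "x = u * y" "is_unit u" "eis_positive y"
  shows "normalize x = y" "unit_factor x = u"
proof -
  have y0: "y \<noteq> 0" using assms(3) eis_positive_coords[of 0 0] by auto
  have "x \<noteq> 0" using assms(1,2) y0 by auto
  have uniq: "v = u \<and> z = y" if v: "is_unit v" "eis_positive z" "x = v * z" for v z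
  proof -
    obtain w where w: "1 = v * w" using v(1) by (elim dvdE)
    have "z = w * v * z" using w by (simp add: mult.commute)
    also have "\<dots> = w * u * y" using v(3) assms(1) by (simp add: mult.assoc)
    finally have z: "z = (w * u) * y" .
    have "is_unit w" using w by (metis dvd_triv_right)
    then have "w * u = 1"
      using positive_associate_unique[OF assms(3), of "w * u"] v(2) z assms(2) by (simp add: is_unit_mult_iff)
    then have "z = y" using z by simp
    moreover have "v = u" using \<open>z = y\<close> v(3) assms(1) y0 by simp
    ultimately show ?thesis by blast
  qed
  have "(THE y. eis_positive y \<and> (\<exists>u. is_unit u \<and> x = u * y)) = y"
    by (rule the_equality) (use assms uniq in blast)+
  then show "normalize x = y"
    using \<open>x \<noteq> 0\<close> by (simp only: normalize_eisenstein_def if_False)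
  have "(THE u. is_unit u \<and> (\<exists>y. eis_positive y \<and> x = u * y)) = u"
    by (rule the_equality) (use assms uniq in blast)+
  then show "unit_factor x = u"
    using \<open>x \<noteq> 0\<close> by (simp only: unit_factor_eisenstein_def if_False)
qed

lemma eis_decomposition_exists:
  assumes "x \<noteq> 0"
  obtains u y where "x = u * y" "is_unit u" "eis_positive y"
proof -
  obtain v where v: "is_unit v" "eis_positive (v * x)"
    using assms by (rule positive_associate_exists)
  obtain w where w: "1 = v * w" using v(1) by (elim dvdE)
  have "x = w * (v * x)" using w by (simp add: mult.assoc[symmetric] mult.commute[of w])
  moreover have "is_unit w" using w by (metis dvd_triv_right)
  ultimately show ?thesis using that v(2) by blast
qed

instance
proof
  fix a b :: eisenstein
  have one: "eis_positive 1" using eis_positive_coords[of 1 0] by simp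
  show "unit_factor (0 :: eisenstein) = 0" by (simp add: unit_factor_eisenstein_def)
  show "normalize (0 :: eisenstein) = 0" by (simp add: normalize_eisenstein_def)
  show "unit_factor a = a" if "is_unit a"
    using eis_decomposition(2)[of a a 1] that one by simp
  show "is_unit (unit_factor a)" if a: "a \<noteq> 0"
  proof -
    obtain u y where "a = u * y" "is_unit u" "eis_positive y"
      using a by (rule eis_decomposition_exists)
    note uy = this
    show ?thesis unfolding eis_decomposition(2)[OF uy] by (rule uy(2))
  qed
  show "unit_factor (a * b) = a * unit_factor b" if "is_unit a"
  proof (cases "b = 0")
    case False
    then obtain u y where "b = u * y" "is_unit u" "eis_positive y"
      by (rule eis_decomposition_exists)
    then show ?thesis
      using eis_decomposition(2)[of "a * b" "a * u" y] eis_decomposition(2)[of b u y] that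
      by (simp add: mult.assoc is_unit_mult_iff)
  qed (simp add: unit_factor_eisenstein_def)
  show "unit_factor a * normalize a = a"
  proof (cases "a = 0")
    case False
    then obtain u y where "a = u * y" "is_unit u" "eis_positive y"
      by (rule eis_decomposition_exists)
    note uy = this
    show ?thesis unfolding eis_decomposition[OF uy] using uy(1) by (rule sym)
  qed (simp add: unit_factor_eisenstein_def)
qed

end

lemma normalize_eq_self_iff: "x \<noteq> 0 \<Longrightarrow> normalize x = x \<longleftrightarrow> eis_positive x"
proof
  assume "x \<noteq> 0" "normalize x = x"
  obtain u y where "x = u * y" "is_unit u" "eis_positive y"
    using \<open>x \<noteq> 0\<close> by (rule eis_decomposition_exists)
  then show "eis_positive x"
    using eis_decomposition(1)[of x u y] \<open>normalize x = x\<close> by metis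
next
  assume "eis_positive x"
  then show "normalize x = x" using eis_decomposition(1)[of x 1 x] by simp
qed

section \<open>Perfect and norm-perfect numbers\<close>

definition positive_primes :: "eisenstein set" where
  "positive_primes = {of_int a + of_int b * \<omega> | a b. a > b \<and> b \<ge> 0} \<inter> {p. prime_elem p}"

lemma positive_primes_eq: "positive_primes = {p. prime p}"
proof -
  have "positive_primes = {p. eis_positive p \<and> prime_elem p}"
    unfolding positive_primes_def eis_positive_def by blast
  moreover have "prime p \<longleftrightarrow> eis_positive p \<and> prime_elem p" for p
    using normalize_eq_self_iff[of p] by (cases "p = 0") (auto simp: prime_def)
  ultimately show ?thesis by auto
qed

text \<open>
  The exponents \<open>e\<^sub>j\<close> are encoded as multiplicities; the lemmas \<open>eis_factorization\<close> and
  \<open>eis_sigma_factorization\<close> below relate this to an explicit factorization.  All quotients are exact.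
\<close>

definition eis_sigma :: "eisenstein \<Rightarrow> eisenstein" where
  "eis_sigma x = (\<Prod>p \<in> {p \<in> positive_primes. p dvd x}. (p ^ (multiplicity p x + 1) - 1) div (p - 1))"

lemma eis_factorization:
  assumes "x \<noteq> 0"
  obtains u where "is_unit u"
    "x = u * (\<Prod>p \<in> {p \<in> positive_primes. p dvd x}. p ^ multiplicity p x)"
proof -
  have P: "{p \<in> positive_primes. p dvd x} = prime_factors x"
    unfolding positive_primes_eq using assms by (auto simp: prime_factors_dvd)
  have "normalize (\<Prod>p \<in> prime_factors x. p ^ multiplicity p x) = normalize x"
  proof -
    have "(\<Prod>p \<in> prime_factors x. p ^ multiplicity p x)
        = (\<Prod>p \<in> prime_factors x. p ^ count (prime_factorization x) p)"
      by (intro prod.cong refl) (auto simp: count_prime_factorization_prime in_prime_factors_iff)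
    then show ?thesis
      using prod_mset_prime_factorization_weak[OF assms] by (simp add: prod_mset_multiplicity)
  qed
  then obtain u where "is_unit u" "x = u * (\<Prod>p \<in> prime_factors x. p ^ multiplicity p x)"
    by (metis associatedE1)
  then show ?thesis using that unfolding P by blast
qed

lemma eis_sigma_factorization:
  assumes "finite S" "S \<subseteq> positive_primes" "is_unit u" "\<And>p. p \<in> S \<Longrightarrow> e p > 0"
  shows "eis_sigma (u * (\<Prod>p \<in> S. p ^ e p)) = (\<Prod>p \<in> S. (p ^ (e p + 1) - 1) div (p - 1))"
proof -
  let ?x = "u * (\<Prod>p \<in> S. p ^ e p)"
  have pr: "prime p" if "p \<in> S" for p using that assms(2) unfolding positive_primes_eq by auto
  then have "0 \<notin> S" by fastforce
  then have z: "0 \<notin> (\<lambda>p. p ^ e p) ` S" by auto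
  have mult: "multiplicity p ?x = (if p \<in> S then e p else 0)" if "prime p" for p
  proof -
    have "multiplicity p ?x = (\<Sum>q \<in> S. multiplicity p (q ^ e q))"
      unfolding multiplicity_times_unit_right[OF assms(3)]
      using assms(1) z that by (intro prime_elem_multiplicity_prod_distrib) auto
    also have "\<dots> = (\<Sum>q \<in> S. if q = p then e q else 0)"
      using pr that by (intro sum.cong) (auto simp: prime_multiplicity_other multiplicity_distinct_prime_power)
    finally show ?thesis using assms(1) by simp
  qed
  have nz: "?x \<noteq> 0" using assms(1,3) \<open>0 \<notin> S\<close> by auto
  have "{p \<in> positive_primes. p dvd ?x} = S"
  proof -
    have "p dvd ?x \<longleftrightarrow> p \<in> S" if p: "prime p" for p
    proof -
      have "p dvd ?x \<longleftrightarrow> multiplicity p ?x > 0"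
        using p nz by (simp add: prime_multiplicity_gt_zero_iff)
      then show ?thesis unfolding mult[OF p] using assms(4) by auto
    qed
    then show ?thesis using pr unfolding positive_primes_eq by blast
  qed
  then show ?thesis
    unfolding eis_sigma_def using mult pr by (intro prod.cong) auto
qed

definition eis_even :: "eisenstein \<Rightarrow> bool" where
  "eis_even x \<longleftrightarrow> (1 - \<omega>^2) dvd x"

definition eis_perfect :: "eisenstein \<Rightarrow> bool" where
  "eis_perfect x \<longleftrightarrow> x \<noteq> 0 \<and> eis_sigma x = (1 - \<omega>^2) * x"

definition eis_norm_perfect :: "eisenstein \<Rightarrow> bool" where
  "eis_norm_perfect x \<longleftrightarrow> x \<noteq> 0 \<and> eis_norm (eis_sigma x) = 3 * eis_norm x"

definition eis_associated :: "eisenstein \<Rightarrow> eisenstein \<Rightarrow> bool" where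
  "eis_associated x y \<longleftrightarrow> (\<exists>u. is_unit u \<and> x = u * y)"

definition primitive_for :: "(eisenstein \<Rightarrow> bool) \<Rightarrow> eisenstein \<Rightarrow> bool" where
  "primitive_for P x \<longleftrightarrow> P x \<and> \<not> (\<exists>y. P y \<and> y dvd x \<and> \<not> eis_associated y x)"

end

theory Submission
  imports Defs
begin

text \<open>
  Put \<open>\<theta> = 1 - \<omega>\<^sup>2\<close>, of norm 3, and write an even number as \<open>\<theta> ^ (k - 1) * b\<close> with \<open>b\<close> odd.  As
  \<open>\<theta> - 1\<close> is a unit, norm-perfection says \<open>N(\<theta> ^ k - 1) * N(\<sigma> b) = 3 ^ k * N(b)\<close>, so every prime
  factor \<open>m\<close> of \<open>\<theta> ^ k - 1\<close> or its conjugate divides \<open>b\<close>.  A positive prime \<open>p \<noteq> \<theta>\<close> of norm \<open>q\<close>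
  satisfies \<open>N(\<sigma>(p ^ e)) / N(p ^ e) > 1 + 2 / q\<close>, because positivity keeps the argument of \<open>p\<close> in
  \<open>[0, \<pi>/3)\<close>.  Hence \<open>3 ^ k / N(\<theta> ^ k - 1) > 1 + 2 / N(m)\<close>: the factor \<open>m\<close> must be large.  For even
  \<open>k\<close> a factor of norm 7 contradicts this.  For odd \<open>k\<close>, \<open>N(\<theta> ^ k - 1) \<le> 3 ^ k\<close> forces
  \<open>k \<equiv> \<plusminus>1\<close> modulo 12, and a factor of norm at most the square root of \<open>N(\<theta> ^ k - 1)\<close> is too small, so
  \<open>\<theta> ^ k - 1\<close> is prime.  Of its two possible positive associates up to conjugation, only the one
  congruent to \<open>-1\<close> modulo \<open>\<theta>\<close> with exponent 1 is admissible, and it already uses up the whole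
  abundancy of \<open>b\<close>.  So every even norm-perfect number has the stated form, and primitivity is automatic.
\<close>

section \<open>Conjugation, norm and the prime above 3\<close>

lemma eis_cnj_simps [simp]:
  "eis_cnj 0 = 0" "eis_cnj 1 = 1" "eis_cnj (x + y) = eis_cnj x + eis_cnj y"
  "eis_cnj (x - y) = eis_cnj x - eis_cnj y" "eis_cnj (x * y) = eis_cnj x * eis_cnj y"
  "eis_cnj (eis_cnj x) = x"
  by (transfer, simp)+

lemma eis_cnj_power [simp]: "eis_cnj (x ^ n) = eis_cnj x ^ n"
  by (induction n) simp_all

lemma eis_cnj_dvd_iff [simp]: "eis_cnj x dvd eis_cnj y \<longleftrightarrow> x dvd y"
  by (metis dvd_def eis_cnj_simps(5,6))

lemma eis_norm_cnj [simp]: "eis_norm (eis_cnj x) = eis_norm x"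
proof -
  have "real_of_int (eis_norm (eis_cnj x)) = real_of_int (eis_norm x)"
    by (simp only: eis_norm_cmod eis_cnj.rep_eq complex_mod_cnj)
  then show ?thesis by (simp only: of_int_eq_iff)
qed

lemma eis_mult_cnj: "x * eis_cnj x = of_int (eis_norm x)"
proof -
  have "complex_of_eis x * cnj (complex_of_eis x) = of_real ((cmod (complex_of_eis x))\<^sup>2)"
    by (simp only: complex_norm_square)
  then show ?thesis
    by (simp add: complex_of_eis_inject[symmetric] times_eisenstein.rep_eq eis_cnj.rep_eq
        complex_of_eis_of_int flip: eis_norm_cmod)
qed

lemma eis_norm_power: "eis_norm (x ^ n) = eis_norm x ^ n"
  by (induction n) (simp_all add: eis_norm_1 eis_norm_mult)

lemma eis_norm_of_int: "eis_norm (of_int a) = a\<^sup>2"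
  using eis_norm_coords[of a 0] by simp

lemma eis_norm_pos: "x \<noteq> 0 \<Longrightarrow> eis_norm x > 0"
  using eis_norm_nonneg[of x] eis_norm_eq_0_iff[of x] by linarith

lemma is_unit_iff_eis_norm: "is_unit x \<longleftrightarrow> eis_norm x = 1"
proof
  assume "is_unit x"
  then obtain y where "1 = x * y" by (elim dvdE)
  then have "eis_norm x * eis_norm y = 1" by (metis eis_norm_1 eis_norm_mult)
  then show "eis_norm x = 1" using eis_norm_nonneg[of x] by (simp add: zmult_eq_1_iff)
next
  assume "eis_norm x = 1"
  then have "x * eis_cnj x = 1" by (simp add: eis_mult_cnj)
  then show "is_unit x" by (metis dvdI)
qed

lemma eis_norm_dvd: "x dvd y \<Longrightarrow> eis_norm x dvd eis_norm y"
  by (metis dvd_def eis_norm_mult)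

lemma prime_elem_eis_cnj [simp]: "prime_elem (eis_cnj x) \<longleftrightarrow> prime_elem x"
proof -
  have "prime_elem (eis_cnj x)" if x: "prime_elem x" for x
  proof (rule prime_elemI)
    show "eis_cnj x \<noteq> 0" using x eis_norm_eq_0_iff[of "eis_cnj x"] eis_norm_eq_0_iff[of x]
      by (simp add: prime_elem_def)
    show "\<not> is_unit (eis_cnj x)" using x by (simp add: is_unit_iff_eis_norm prime_elem_def)
    show "eis_cnj x dvd a \<or> eis_cnj x dvd b" if "eis_cnj x dvd a * b" for a b
    proof -
      have "x dvd eis_cnj a * eis_cnj b" using that eis_cnj_dvd_iff[of "eis_cnj x" "a * b"] by simp
      then have "x dvd eis_cnj a \<or> x dvd eis_cnj b" using x by (simp add: prime_elem_dvd_mult_iff)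
      then show ?thesis using eis_cnj_dvd_iff[of x "eis_cnj a"] eis_cnj_dvd_iff[of x "eis_cnj b"] by simp
    qed
  qed
  from this[of x] this[of "eis_cnj x"] show ?thesis by auto
qed

text \<open>A factorization of \<open>x\<close> also factors the rational prime
  \<open>eis_norm x\<close>, so one factor has norm 1 and is a unit; irreducible elements are prime
  because the ring is Euclidean.\<close>

lemma prime_elem_if_prime_eis_norm:
  assumes "prime (eis_norm x)"
  shows "prime_elem x"
proof (rule irreducible_imp_prime_elem, rule irreducibleI)
  show "x \<noteq> 0" using assms eis_norm_eq_0_iff[of x] by auto
  show "\<not> is_unit x" using assms by (auto simp: is_unit_iff_eis_norm)
  fix a b assume "x = a * b"
  then have "prime (eis_norm a * eis_norm b)" using assms by (simp add: eis_norm_mult)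
  then have "is_unit (eis_norm a) \<or> is_unit (eis_norm b)"
    by (metis irreducible_def prime_def prime_elem_imp_irreducible)
  then show "is_unit a \<or> is_unit b"
    using eis_norm_nonneg[of a] eis_norm_nonneg[of b] by (auto simp: is_unit_iff_eis_norm)
qed

lemma eis_norm_normalize [simp]: "eis_norm (normalize x) = eis_norm x"
proof (cases "x = 0")
  case False
  then have "is_unit (unit_factor x)" by simp
  then show ?thesis
    using arg_cong[OF unit_factor_mult_normalize[of x], of eis_norm]
    by (simp add: eis_norm_mult is_unit_iff_eis_norm del: unit_factor_mult_normalize)
qed simp

lemma eis_cnj_omega: "eis_cnj \<omega> = - 1 - \<omega>"
  by transfer (simp add: complex_eq_iff cos_120 sin_120)

lemma eis_cnj_of_int [simp]: "eis_cnj (of_int a) = of_int a" "eis_cnj (numeral n) = numeral n"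
proof -
  show of_int: "eis_cnj (of_int a) = of_int a" for a
    by (simp add: complex_of_eis_inject[symmetric] eis_cnj.rep_eq complex_of_eis_of_int)
  show "eis_cnj (numeral n) = numeral n" using of_int[of "numeral n"] by simp
qed

definition eis_theta :: eisenstein (\<open>\<theta>\<close>) where "\<theta> = of_int 2 + of_int 1 * \<omega>"

lemma one_minus_omega_square: "1 - \<omega>\<^sup>2 = \<theta>"
  by (simp add: eis_theta_def power2_eq_square omega_square)

lemma eis_norm_theta: "eis_norm \<theta> = 3"
  unfolding eis_theta_def eis_norm_coords by simp

lemma prime_theta: "prime \<theta>"
proof -
  have "prime_elem \<theta>" by (rule prime_elem_if_prime_eis_norm) (simp add: eis_norm_theta)
  moreover have "eis_positive \<theta>" unfolding eis_theta_def eis_positive_coords by simp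
  ultimately show ?thesis
    using normalize_eq_self_iff[of \<theta>] by (auto simp: prime_def)
qed

text \<open>Dividing by \<open>\<theta> - 1\<close> in the divisor sum amounts to multiplying by
  \<open>- \<omega>\<close>. This leaves norms unchanged and is the source of the special unit in
  the perfect case.\<close>

lemma theta_minus_one: "- \<omega> * (\<theta> - 1) = 1" "eis_norm (\<theta> - 1) = 1"
proof -
  show unit: "- \<omega> * (\<theta> - 1) = 1" by (simp add: eis_theta_def algebra_simps omega_square)
  have "is_unit (\<theta> - 1)" by (metis unit dvd_triv_right)
  then show "eis_norm (\<theta> - 1) = 1" by (simp add: is_unit_iff_eis_norm)
qed

lemma prime_iff_positive: "prime x \<longleftrightarrow> eis_positive x \<and> prime_elem x" for x :: eisenstein
  using normalize_eq_self_iff[of x] by (cases "x = 0") (auto simp: prime_def)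

lemma prime_coords:
  assumes "prime p"
  obtains a b where "p = of_int a + of_int b * \<omega>" "a > b" "b \<ge> 0"
  using assms unfolding prime_iff_positive eis_positive_def by blast

section \<open>The divisor sum\<close>

lemma geometric_quotient:
  assumes "(p :: eisenstein) \<noteq> 1"
  shows "(p ^ n - 1) div (p - 1) * (p - 1) = p ^ n - 1"
proof -
  have "p - 1 dvd p ^ n - 1" by (metis dvd_triv_left power_diff_1_eq)
  then show ?thesis by (rule dvd_div_mult_self)
qed

lemma eis_sigma_unit_mult:
  assumes "is_unit u"
  shows "eis_sigma (u * x) = eis_sigma x"
  unfolding eis_sigma_def multiplicity_times_unit_right[OF assms] dvd_mult_unit_iff'[OF assms] ..

lemma eis_sigma_is_unit:
  assumes "is_unit u"
  shows "eis_sigma u = 1"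
proof -
  have "{p \<in> positive_primes. p dvd u} = {}"
    using assms not_prime_unit dvd_trans unfolding positive_primes_eq by blast
  then show ?thesis unfolding eis_sigma_def by (simp only: prod.empty)
qed

lemma eis_sigma_prime_power_mult:
  assumes p: "prime p" and x: "x \<noteq> 0" "\<not> p dvd x"
  shows "eis_sigma (p ^ e * x) = (p ^ (e + 1) - 1) div (p - 1) * eis_sigma x"
proof (cases "e = 0")
  \<comment> \<open>Here \<open>p\<close> is not among the prime divisors at all, and the quotient
    is \<open>(p - 1) div (p - 1) = 1\<close>.\<close>
  case True
  have "p \<noteq> 1" using p by auto
  then show ?thesis using True by simp
next
  case False
  let ?S = "{q \<in> positive_primes. q dvd x}"
  have fin: "finite ?S"
    using x(1) unfolding positive_primes_eq
    by (metis (mono_tags, lifting) finite_prime_divisors mem_Collect_eq Collect_cong)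
  have p0: "p ^ e \<noteq> 0" using p by auto
  have "q = p" if "prime q" "q dvd p ^ e" for q
    using that p prime_dvd_power primes_dvd_imp_eq by blast
  then have S: "{q \<in> positive_primes. q dvd p ^ e * x} = insert p ?S"
    using p False unfolding positive_primes_eq
    by (auto simp: prime_dvd_mult_iff)
  have mp: "multiplicity p (p ^ e * x) = e"
    using p x p0 by (simp add: prime_elem_multiplicity_mult_distrib not_dvd_imp_multiplicity_0)
  have mq: "multiplicity q (p ^ e * x) = multiplicity q x" if "q \<in> ?S" for q
  proof -
    have q: "prime q" "q \<noteq> p" using that x(2) unfolding positive_primes_eq by auto
    then show ?thesis using p x p0
      by (simp add: prime_elem_multiplicity_mult_distrib multiplicity_distinct_prime_power)
  qed
  have "p \<notin> ?S" using x(2) by simp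
  then have "eis_sigma (p ^ e * x) = (p ^ (e + 1) - 1) div (p - 1) *
      (\<Prod>q \<in> ?S. (q ^ (multiplicity q (p ^ e * x) + 1) - 1) div (q - 1))"
    unfolding eis_sigma_def S using fin mp by simp
  also have "(\<Prod>q \<in> ?S. (q ^ (multiplicity q (p ^ e * x) + 1) - 1) div (q - 1)) = eis_sigma x"
    unfolding eis_sigma_def by (intro prod.cong refl) (simp only: mq)
  finally show ?thesis .
qed

lemma eis_sigma_prime_power:
  assumes "prime p"
  shows "eis_sigma (p ^ e) * (p - 1) = p ^ (e + 1) - 1"
proof -
  have "\<not> p dvd 1" "p \<noteq> 1" using assms by auto
  then show ?thesis
    using eis_sigma_prime_power_mult[OF assms, of 1 e] eis_sigma_is_unit[of 1]
      geometric_quotient[of p "e + 1"] by simp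
qed

lemma eis_sigma_prime_power_mult':
  assumes "prime p" "x \<noteq> 0" "\<not> p dvd x"
  shows "eis_sigma (p ^ e * x) = eis_sigma (p ^ e) * eis_sigma x"
  using eis_sigma_prime_power_mult[OF assms, of e] eis_sigma_prime_power_mult[OF assms(1), of 1 e] assms
  by (simp add: eis_sigma_is_unit)

lemma eis_sigma_prime:
  assumes "prime p"
  shows "eis_sigma p = p + 1"
proof -
  have "p - 1 \<noteq> 0" using assms by auto
  moreover have "eis_sigma p * (p - 1) = (p + 1) * (p - 1)"
    using eis_sigma_prime_power[OF assms, of 1] by (simp add: algebra_simps power2_eq_square)
  ultimately show ?thesis by simp
qed

lemma eis_norm_sigma_theta_power: "eis_norm (eis_sigma (\<theta> ^ n)) = eis_norm (\<theta> ^ (n + 1) - 1)"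
  using arg_cong[OF eis_sigma_prime_power[OF prime_theta, of n], of eis_norm]
  by (simp add: eis_norm_mult theta_minus_one(2))

section \<open>Lower bounds for the divisor sum\<close>

lemma eis_norm_minus_one_bounds:
  fixes r :: real
  assumes "r \<ge> 1" "r\<^sup>2 = eis_norm x"
  shows "(r - 1)\<^sup>2 \<le> eis_norm (x - 1)" "eis_norm (x - 1) \<le> (r + 1)\<^sup>2"
proof -
  have r: "cmod (complex_of_eis x) = r"
    by (rule power2_eq_imp_eq) (use assms(1) in \<open>simp_all add: assms(2) eis_norm_cmod\<close>)
  have d: "complex_of_eis (x - 1) = complex_of_eis x - 1"
    by (simp add: minus_eisenstein.rep_eq one_eisenstein.rep_eq)
  have "r - 1 \<le> cmod (complex_of_eis (x - 1))" "cmod (complex_of_eis (x - 1)) \<le> r + 1"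
    unfolding d r[symmetric]
    using norm_triangle_ineq2[of "complex_of_eis x" 1] norm_triangle_ineq4[of "complex_of_eis x" 1]
    by simp_all
  then show "(r - 1)\<^sup>2 \<le> eis_norm (x - 1)" "eis_norm (x - 1) \<le> (r + 1)\<^sup>2"
    unfolding eis_norm_cmod using assms(1) by (simp_all add: power_mono)
qed

text \<open>With \<open>r\<close> the absolute value of \<open>x\<close> and
  \<open>y = r ^ n\<close>, the norm is at least \<open>(y - 1)\<^sup>2 > y\<^sup>2 - 2 * y\<close>.
  Since \<open>y \<ge> r ^ 3 \<ge> c * r\<^sup>2\<close>, the loss \<open>2 * y\<close> is at most
  the fraction \<open>2 / (c * r\<^sup>2)\<close> of \<open>y\<^sup>2\<close>. The lower bound
  \<open>c\<close> for \<open>r\<close> will be 2 for a general odd prime and 4 for one of Mersenne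
  type.\<close>

lemma eis_norm_power_minus_one:
  fixes c :: real
  assumes c: "c > 0" "eis_norm x \<ge> c\<^sup>2" and n: "n \<ge> 3" and x: "eis_norm x > 1"
  shows "c * eis_norm x * eis_norm (x ^ n - 1) > (c * eis_norm x - 2) * eis_norm x ^ n"
proof -
  define r where "r = sqrt (eis_norm x)"
  have q: "real_of_int (eis_norm x) = r\<^sup>2" using x by (simp add: r_def)
  have r: "r \<ge> c" unfolding r_def using c by (simp add: real_le_rsqrt)
  have r1: "r > 1" unfolding r_def using x by simp
  define y where "y = r ^ n"
  have y1: "y \<ge> 1" unfolding y_def using r1 by simp
  have y2: "y\<^sup>2 = eis_norm (x ^ n)"
    unfolding y_def eis_norm_power of_int_power q by (simp add: power_mult[symmetric] mult.commute)
  have "eis_norm (x ^ n - 1) \<ge> (y - 1)\<^sup>2" using y1 y2 by (rule eis_norm_minus_one_bounds)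
  then have N: "eis_norm (x ^ n - 1) > y\<^sup>2 - 2 * y" by (simp add: power2_eq_square algebra_simps)
  have "c * r\<^sup>2 \<le> r * r\<^sup>2" using r by (rule mult_right_mono) simp
  also have "r * r\<^sup>2 = r ^ 3" by (simp add: power3_eq_cube power2_eq_square)
  also have "r ^ 3 \<le> y" unfolding y_def using r1 n by (intro power_increasing) auto
  finally have y: "c * r\<^sup>2 \<le> y" .
  have "(c * r\<^sup>2 - 2) * y\<^sup>2 \<le> c * r\<^sup>2 * (y\<^sup>2 - 2 * y)"
    using mult_right_mono[OF y, of y] y1 by (simp add: power2_eq_square algebra_simps)
  also have "\<dots> < c * r\<^sup>2 * eis_norm (x ^ n - 1)" using N c r1 by (intro mult_strict_left_mono) auto
  finally show ?thesis using y2 q by (simp add: eis_norm_power)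
qed

text \<open>In coordinates, adding or subtracting 1 changes the norm by
  \<open>1 + (2 * a - b)\<close> or \<open>1 - (2 * a - b)\<close>. Positivity, with 1 and
  \<open>\<theta>\<close> excluded, forces \<open>2 * a - b \<ge> 4\<close>.\<close>

lemma odd_prime_norm_bounds:
  assumes p: "prime p" "p \<noteq> \<theta>"
  shows "eis_norm p \<ge> 4" "eis_norm (p + 1) > eis_norm p + 2" "eis_norm (p - 1) \<le> eis_norm p - 3"
proof -
  obtain a b where ab: "p = of_int a + of_int b * \<omega>" "a > b" "b \<ge> 0" using p(1) by (rule prime_coords)
  have "\<not> (a = 1 \<and> b = 0)" "\<not> (a = 2 \<and> b = 1)" using p ab(1) by (auto simp: eis_theta_def)
  then have "(a = 2 \<and> b = 0) \<or> a \<ge> 3" using ab by presburger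
  then have m: "2 * a - b \<ge> 4" using ab by auto
  have p1: "p + 1 = of_int (a + 1) + of_int b * \<omega>" "p - 1 = of_int (a - 1) + of_int b * \<omega>"
    using ab by simp_all
  show "eis_norm (p + 1) > eis_norm p + 2" "eis_norm (p - 1) \<le> eis_norm p - 3"
    unfolding p1 unfolding ab(1) eis_norm_coords using m by (simp_all add: power2_eq_square algebra_simps)
  then show "eis_norm p \<ge> 4" using eis_norm_pos[of "p - 1"] p(1) by fastforce
qed

text \<open>Write \<open>q\<close> for the norm of \<open>p\<close>. Exponent 1 is the bound on the
  norm of \<open>p + 1\<close>. For larger exponents the quotient formula puts the ratio of norms
  above \<open>(q - 1) / (q - 3)\<close>, which exceeds \<open>(q + 2) / q\<close> because
  \<open>(q + 2) * (q - 3) = q * (q - 1) - 6\<close>.\<close>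

lemma sigma_odd_prime_power_gt:
  assumes p: "prime p" "p \<noteq> \<theta>" and e: "e > 0"
  shows "eis_norm p * eis_norm (eis_sigma (p ^ e)) > (eis_norm p + 2) * eis_norm (p ^ e)"
proof (cases "e = 1")
  case True
  then show ?thesis
    using odd_prime_norm_bounds[OF p] p by (simp add: eis_sigma_prime)
next
  case False
  define q where "q = eis_norm p"
  define s where "s = eis_norm (eis_sigma (p ^ e))"
  note b = odd_prime_norm_bounds[OF p, folded q_def]
  have qe: "q ^ e > 0" using b by simp
  have "real_of_int (2 * q * eis_norm (p ^ (e + 1) - 1)) > real_of_int ((2 * q - 2) * q ^ (e + 1))"
    using eis_norm_power_minus_one[of 2 p "e + 1"] b False e by (simp add: q_def)
  then have "q * ((q - 1) * q ^ e) < q * eis_norm (p ^ (e + 1) - 1)"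
    unfolding of_int_less_iff by (simp add: algebra_simps)
  then have "(q - 1) * q ^ e < eis_norm (p ^ (e + 1) - 1)" using b by simp
  also have "\<dots> = s * eis_norm (p - 1)"
    unfolding s_def eis_norm_mult[symmetric] eis_sigma_prime_power[OF p(1)] ..
  also have "\<dots> \<le> s * (q - 3)"
    using b by (intro mult_left_mono) (auto simp: s_def eis_norm_nonneg)
  finally have "q * ((q - 1) * q ^ e) < q * (s * (q - 3))" using b by simp
  moreover have "(q + 2) * (q - 3) * q ^ e \<le> q * (q - 1) * q ^ e"
    using qe by (intro mult_right_mono) (auto simp: algebra_simps)
  ultimately have "((q + 2) * q ^ e) * (q - 3) < (q * s) * (q - 3)" by (simp add: algebra_simps)
  then have "(q + 2) * q ^ e < q * s" using b by simp
  then show ?thesis by (simp add: q_def s_def eis_norm_power)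
qed

lemma prime_power_split:
  assumes "x \<noteq> 0" "prime p" "p dvd x"
  obtains e y where "e > 0" "x = p ^ e * y" "y \<noteq> 0" "\<not> p dvd y"
    "eis_sigma x = eis_sigma (p ^ e) * eis_sigma y"
proof -
  have "\<not> is_unit p" using assms by auto
  then obtain y where y: "x = p ^ multiplicity p x * y" "\<not> p dvd y"
    using multiplicity_decompose'[of x p] assms(1) by metis
  have "multiplicity p x > 0" using assms by (simp add: prime_multiplicity_gt_zero_iff)
  moreover have "y \<noteq> 0" using assms y by auto
  ultimately show ?thesis
    using that[OF _ y(1) _ y(2)] eis_sigma_prime_power_mult'[OF assms(2) _ y(2)] y(1) by metis
qed

text \<open>The ratio of the norms of \<open>eis_sigma x\<close> and \<open>x\<close> is
  multiplicative over coprime factors and exceeds 1 on every odd prime power; the induction strips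
  off one prime power at a time.\<close>

lemma eis_norm_sigma_odd:
  assumes "x \<noteq> 0" "\<not> \<theta> dvd x"
  shows "eis_norm (eis_sigma x) \<ge> eis_norm x \<and> (\<not> is_unit x \<longrightarrow> eis_norm (eis_sigma x) > eis_norm x)"
  using assms
proof (induction "nat (eis_norm x)" arbitrary: x rule: less_induct)
  case less
  show ?case
  proof (cases "is_unit x")
    case True
    then show ?thesis using is_unit_iff_eis_norm[of x] by (simp add: eis_sigma_is_unit eis_norm_1)
  next
    case False
    then obtain p where p: "p dvd x" "prime p" using less.prems prime_divisor_exists by blast
    obtain e y where y: "e > 0" "x = p ^ e * y" "y \<noteq> 0" "\<not> p dvd y"
      "eis_sigma x = eis_sigma (p ^ e) * eis_sigma y"
      using prime_power_split[OF less.prems(1) p(2,1)] .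
    have pt: "p \<noteq> \<theta>" using p less.prems by auto
    define q where "q = eis_norm (p ^ e)"
    have N: "eis_norm x = q * eis_norm y" using y(2) by (simp add: q_def eis_norm_mult)
    have p4: "eis_norm p \<ge> 4" using odd_prime_norm_bounds[OF p(2) pt] by simp
    have q1: "q > 1" unfolding q_def eis_norm_power using p4 y(1) by (simp add: one_less_power)
    have "eis_norm y < eis_norm x"
      unfolding N using q1 eis_norm_pos[OF y(3)] by simp
    moreover have "\<not> \<theta> dvd y" using less.prems(2) y(2) by auto
    ultimately have IH: "eis_norm (eis_sigma y) \<ge> eis_norm y"
      using less.hyps[of y] y(3) eis_norm_nonneg[of y] by auto
    have "eis_norm p * eis_norm (eis_sigma (p ^ e)) > eis_norm p * q"
    proof -
      have "eis_norm p * q \<le> (eis_norm p + 2) * q" using q1 by simp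
      then show ?thesis using sigma_odd_prime_power_gt[OF p(2) pt y(1)] unfolding q_def by linarith
    qed
    then have S: "eis_norm (eis_sigma (p ^ e)) > q" using p4 by simp
    have "q * eis_norm y < eis_norm (eis_sigma (p ^ e)) * eis_norm y"
      using S eis_norm_pos[OF y(3)] by simp
    also have "\<dots> \<le> eis_norm (eis_sigma (p ^ e)) * eis_norm (eis_sigma y)"
      using IH by (intro mult_left_mono eis_norm_nonneg)
    finally show ?thesis unfolding N y(5) eis_norm_mult by simp
  qed
qed

section \<open>Powers of the prime above 3\<close>

lemma omega_mult_omega_mult: "\<omega> * (\<omega> * x) = - x - \<omega> * x"
  by (simp add: omega_square algebra_simps flip: mult.assoc)

lemma theta_square: "\<theta>\<^sup>2 = 3 * (1 + \<omega>)"
  by (simp add: eis_theta_def power2_eq_square algebra_simps omega_square)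

lemma one_plus_omega_power_6: "(1 + \<omega>) ^ 6 = 1"
proof -
  have "(1 + \<omega>) ^ 3 = - 1" by (simp add: power3_eq_cube algebra_simps omega_square)
  then have "((1 + \<omega>) ^ 3)\<^sup>2 = 1" by simp
  then show ?thesis by (simp flip: power_mult)
qed

text \<open>As \<open>\<theta>\<^sup>2\<close> is 3 times the sixth root of unity
  \<open>1 + \<omega>\<close>, an odd power of \<open>\<theta>\<close> is a power of 3 times one of
  six rotations of \<open>\<theta>\<close>. This is where the residues modulo 12 come from.\<close>

lemma theta_odd_power: "\<theta> ^ (2 * j + 1) = of_int (3 ^ j) * ((1 + \<omega>) ^ (j mod 6) * \<theta>)"
proof -
  have "(1 + \<omega>) ^ j = (1 + \<omega>) ^ (6 * (j div 6) + j mod 6)" by simp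
  also have "\<dots> = (1 + \<omega>) ^ (j mod 6)"
    unfolding power_add power_mult one_plus_omega_power_6 by simp
  finally show ?thesis by (simp only: power_add power_mult theta_square power_mult_distrib
      power_one_right of_int_power of_int_numeral mult.assoc)
qed

lemma one_plus_omega_mult:
  "(1 + \<omega>) * (of_int a + of_int b * \<omega>) = of_int (a - b) + of_int a * \<omega>"
  by (simp add: algebra_simps omega_mult_omega_mult)

lemma one_plus_omega_power_theta:
  "(1 + \<omega>) ^ 0 * \<theta> = of_int 2 + of_int 1 * \<omega>"
  "(1 + \<omega>) ^ 1 * \<theta> = of_int 1 + of_int 2 * \<omega>"
  "(1 + \<omega>) ^ 2 * \<theta> = of_int (- 1) + of_int 1 * \<omega>"
  "(1 + \<omega>) ^ 3 * \<theta> = of_int (- 2) + of_int (- 1) * \<omega>"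
  "(1 + \<omega>) ^ 4 * \<theta> = of_int (- 1) + of_int (- 2) * \<omega>"
  "(1 + \<omega>) ^ 5 * \<theta> = of_int 1 + of_int (- 1) * \<omega>"
proof -
  show 0: "(1 + \<omega>) ^ 0 * \<theta> = of_int 2 + of_int 1 * \<omega>" by (simp add: eis_theta_def)
  have step: "(1 + \<omega>) ^ Suc n * \<theta> = (1 + \<omega>) * ((1 + \<omega>) ^ n * \<theta>)" for n
    by (simp add: mult.assoc)
  show 1: "(1 + \<omega>) ^ 1 * \<theta> = of_int 1 + of_int 2 * \<omega>"
    unfolding One_nat_def step 0 one_plus_omega_mult by simp
  show 2: "(1 + \<omega>) ^ 2 * \<theta> = of_int (- 1) + of_int 1 * \<omega>"
    using step[of 1] unfolding 1 one_plus_omega_mult by (simp add: numeral_2_eq_2)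
  show 3: "(1 + \<omega>) ^ 3 * \<theta> = of_int (- 2) + of_int (- 1) * \<omega>"
    using step[of 2] unfolding 2 one_plus_omega_mult by (simp add: numeral_3_eq_3 numeral_2_eq_2)
  show 4: "(1 + \<omega>) ^ 4 * \<theta> = of_int (- 1) + of_int (- 2) * \<omega>"
    using step[of 3] unfolding 3 one_plus_omega_mult by simp
  show "(1 + \<omega>) ^ 5 * \<theta> = of_int 1 + of_int (- 1) * \<omega>"
    using step[of 4] unfolding 4 one_plus_omega_mult by simp
qed

lemma eis_norm_scaled_minus_one:
  "eis_norm (of_int A * (of_int a + of_int b * \<omega>) - 1) =
    A\<^sup>2 * (a\<^sup>2 - a * b + b\<^sup>2) - (2 * a - b) * A + 1"
proof -
  have eq: "of_int A * (of_int a + of_int b * \<omega>) - 1 = of_int (A * a - 1) + of_int (A * b) * \<omega>"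
    by (simp add: algebra_simps)
  then show ?thesis
    unfolding eq eis_norm_coords by (simp add: power2_eq_square algebra_simps)
qed

text \<open>
  For \<open>k = 2j + 1\<close> this is the positive one among \<open>\<theta> ^ k - 1\<close> (if \<open>k \<equiv> 1\<close> modulo 12) and its
  conjugate (if \<open>k \<equiv> -1\<close>), so it covers both families at once.
\<close>
definition eis_mersenne :: "nat \<Rightarrow> eisenstein" where
  "eis_mersenne j = of_int (3 ^ j) * \<theta> - 1"

lemma eis_mersenne_coords: "eis_mersenne j = of_int (2 * 3 ^ j - 1) + of_int (3 ^ j) * \<omega>"
  by (simp add: eis_mersenne_def eis_theta_def algebra_simps)

text \<open>The second equation is the decisive one: if \<open>eis_mersenne j\<close> is prime, its
  divisor sum \<open>eis_mersenne j + 1\<close> has norm exactly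
  \<open>3 ^ (2 * j + 1)\<close>.\<close>

lemma eis_norm_mersenne:
  "eis_norm (eis_mersenne j) = 3 * (3 ^ j)\<^sup>2 - 3 * 3 ^ j + 1"
  "eis_norm (eis_mersenne j + 1) = 3 * (3 ^ j)\<^sup>2"
  "eis_norm (eis_mersenne j - 1) = eis_norm (eis_mersenne j) - 3 * 3 ^ j + 3"
proof -
  show "eis_norm (eis_mersenne j) = 3 * (3 ^ j)\<^sup>2 - 3 * 3 ^ j + 1"
    unfolding eis_mersenne_coords eis_norm_coords by (simp add: power2_eq_square algebra_simps)
  show "eis_norm (eis_mersenne j + 1) = 3 * (3 ^ j)\<^sup>2"
    by (simp only: eis_mersenne_def diff_add_cancel eis_norm_mult eis_norm_theta eis_norm_of_int mult.commute)
  have eq: "eis_mersenne j - 1 = of_int (2 * 3 ^ j - 2) + of_int (3 ^ j) * \<omega>"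
    by (simp add: eis_mersenne_coords)
  then show "eis_norm (eis_mersenne j - 1) = eis_norm (eis_mersenne j) - 3 * 3 ^ j + 3"
    unfolding eq unfolding eis_mersenne_coords eis_norm_coords
    by (simp add: power2_eq_square algebra_simps)
qed

lemma eis_positive_mersenne: "j > 0 \<Longrightarrow> eis_positive (eis_mersenne j)"
  unfolding eis_mersenne_coords eis_positive_coords
  using one_less_power[of "3::int" j] by simp

text \<open>The conjugate has a negative second coordinate, so it is not positive; rotation by
  \<open>1 + \<omega>\<close> moves it into the positive sector.\<close>

lemma mersenne_cnj_associate:
  "(1 + \<omega>) * eis_cnj (eis_mersenne j) = of_int (2 * 3 ^ j - 1) + of_int (3 ^ j - 1) * \<omega>"
  unfolding eis_mersenne_coords by (simp add: eis_cnj_omega algebra_simps omega_mult_omega_mult omega_square)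

lemma eis_cnj_theta: "eis_cnj \<theta> = of_int 1 + of_int (- 1) * \<omega>"
  by (simp add: eis_theta_def eis_cnj_omega)

lemma theta_power_minus_one_mersenne:
  "j mod 6 = 0 \<Longrightarrow> \<theta> ^ (2 * j + 1) - 1 = eis_mersenne j"
  "j mod 6 = 5 \<Longrightarrow> \<theta> ^ (2 * j + 1) - 1 = eis_cnj (eis_mersenne j)"
proof -
  show "\<theta> ^ (2 * j + 1) - 1 = eis_mersenne j" if "j mod 6 = 0"
    unfolding theta_odd_power that by (simp add: eis_mersenne_def)
  show "\<theta> ^ (2 * j + 1) - 1 = eis_cnj (eis_mersenne j)" if "j mod 6 = 5"
    unfolding theta_odd_power that one_plus_omega_power_theta eis_mersenne_def
      eis_cnj_simps eis_cnj_theta eis_cnj_of_int ..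
qed

text \<open>With \<open>A = 3 ^ j\<close> the norm is
  \<open>3 * A\<^sup>2 - (2 * a - b) * A + 1\<close>, where \<open>2 * a - b\<close> runs through 3,
  0, -3, -3, 0, 3 as \<open>j mod 6\<close> runs from 0 to 5. Residues 1 and 4 exceed the bound only
  by the constant 1.\<close>

lemma theta_odd_power_norm_le:
  assumes "eis_norm (\<theta> ^ (2 * j + 1) - 1) \<le> 3 ^ (2 * j + 1)"
  shows "j mod 6 = 0 \<or> j mod 6 = 5"
proof (rule ccontr)
  assume "\<not> ?thesis"
  then have "j mod 6 \<in> {1, 2, 3, 4}" using mod_less_divisor[of 6 j] by auto
  moreover have "(0::int) < 3 ^ j" by simp
  moreover have "(3::int) ^ (2 * j + 1) = 3 * (3 ^ j)\<^sup>2" by (simp flip: power_mult add: mult.commute)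
  ultimately have "eis_norm (\<theta> ^ (2 * j + 1) - 1) > 3 ^ (2 * j + 1)"
    unfolding theta_odd_power
    by (elim insertE emptyE; simp only: one_plus_omega_power_theta eis_norm_scaled_minus_one; simp)
  then show False using assms by simp
qed

section \<open>Size and primality of \<open>\<theta> ^ k - 1\<close>\<close>

lemma theta_power_minus_one_bounds:
  fixes x :: real
  assumes x: "x \<ge> 1" "x\<^sup>2 = 3 ^ k"
  shows "(x - 1)\<^sup>2 \<le> eis_norm (\<theta> ^ k - 1)" "eis_norm (\<theta> ^ k - 1) \<le> (x + 1)\<^sup>2"
  using eis_norm_minus_one_bounds[of x "\<theta> ^ k"] assms by (simp_all add: eis_norm_power eis_norm_theta)

lemma theta_power_minus_one_not_unit:
  assumes "k \<ge> 2"
  shows "eis_norm (\<theta> ^ k - 1) > 1"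
proof (cases "k = 2")
  case True
  have eq: "\<theta> ^ k - 1 = of_int 3 * (of_int 1 + of_int 1 * \<omega>) - 1" using theta_square True by simp
  then show ?thesis unfolding eq eis_norm_scaled_minus_one by simp
next
  case False
  define x :: real where "x = sqrt (3 ^ k)"
  have "(5::real)\<^sup>2 \<le> 3 ^ 3" by simp
  also have "\<dots> \<le> 3 ^ k" using False assms by (intro power_increasing) auto
  finally have x: "x \<ge> 5" unfolding x_def by (intro real_le_rsqrt) simp
  have "1 < (5 - 1 :: real)\<^sup>2" by simp
  also have "\<dots> \<le> (x - 1)\<^sup>2" using x by (intro power_mono) auto
  also have "\<dots> \<le> eis_norm (\<theta> ^ k - 1)"
    using x by (intro theta_power_minus_one_bounds) (simp_all add: x_def)
  finally show ?thesis by simp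
qed

text \<open>The ratio 7/9 is attained at \<open>j = 1\<close>, and it is the reciprocal of 1 + 2/7,
  the abundancy that a prime factor of norm 7 forces. For larger \<open>j\<close> the triangle
  inequality suffices.\<close>

lemma eis_norm_theta_even_power:
  assumes "j > 0"
  shows "9 * eis_norm (\<theta> ^ (2 * j) - 1) \<ge> 7 * 3 ^ (2 * j)"
proof (cases "j = 1")
  case True
  have eq: "\<theta> ^ (2 * j) - 1 = of_int 3 * (of_int 1 + of_int 1 * \<omega>) - 1" using theta_square True by simp
  then show ?thesis unfolding eq eis_norm_scaled_minus_one using True by simp
next
  case False
  define x :: real where "x = 3 ^ j"
  have "3 ^ 2 \<le> x" unfolding x_def using False assms by (intro power_increasing) auto
  then have x: "x \<ge> 9" by simp
  have x2: "x\<^sup>2 = 3 ^ (2 * j)" by (simp add: x_def mult.commute flip: power_mult)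
  have "0 \<le> 2 * (x - 9) * x" using x by simp
  then have "7 * x\<^sup>2 \<le> 9 * (x - 1)\<^sup>2" by (simp add: power2_eq_square algebra_simps)
  also have "\<dots> \<le> 9 * eis_norm (\<theta> ^ (2 * j) - 1)"
    using theta_power_minus_one_bounds(1)[of x "2 * j"] x x2 by simp
  finally have "real_of_int (7 * 3 ^ (2 * j)) \<le> real_of_int (9 * eis_norm (\<theta> ^ (2 * j) - 1))"
    by (simp add: x2)
  then show ?thesis by (simp only: of_int_le_iff)
qed

text \<open>If \<open>k = a * b\<close> properly, the nonunit \<open>\<theta> ^ a - 1\<close>
  divides \<open>\<theta> ^ k - 1\<close>, so primality makes their norms equal. With
  \<open>x\<close> the absolute value of \<open>\<theta> ^ a\<close> this gives
  \<open>x ^ b - 1 \<le> x + 1\<close>, against \<open>x ^ b \<ge> 3 * x\<close> and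
  \<open>x \<ge> 3\<close>.\<close>

lemma theta_power_minus_one_prime_imp_prime:
  assumes pr: "prime_elem (\<theta> ^ k - 1)" and k: "k \<ge> 2"
  shows "prime k"
proof (rule ccontr)
  assume "\<not> prime k"
  then obtain a where a: "a dvd k" "a \<noteq> 1" "a \<noteq> k" using k by (auto simp: prime_nat_iff)
  then obtain b where b: "k = a * b" by (elim dvdE)
  then have "a \<noteq> 0" "b \<noteq> 0" using k by (metis mult_0 mult_0_right not_numeral_le_zero)+
  moreover have "b \<noteq> 1" using a b by auto
  ultimately have ab: "k = a * b" "a \<ge> 2" "b \<ge> 2" using a b by auto
  have "\<theta> ^ a - 1 dvd (\<theta> ^ a) ^ b - 1" by (metis dvd_triv_left power_diff_1_eq)
  then obtain c where c: "\<theta> ^ k - 1 = (\<theta> ^ a - 1) * c" unfolding ab(1) power_mult by (elim dvdE)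
  have "\<not> is_unit (\<theta> ^ a - 1)"
    using theta_power_minus_one_not_unit[OF ab(2)] by (simp add: is_unit_iff_eis_norm)
  then have "is_unit c" using irreducibleD[OF prime_elem_imp_irreducible[OF pr] c] by blast
  then have N: "eis_norm (\<theta> ^ k - 1) = eis_norm (\<theta> ^ a - 1)"
    by (simp add: c eis_norm_mult is_unit_iff_eis_norm)
  define x :: real where "x = sqrt (3 ^ a)"
  have "(3::real) ^ 2 \<le> 3 ^ a" using ab by (intro power_increasing) auto
  then have x: "x \<ge> 3" unfolding x_def by (intro real_le_rsqrt) simp
  have x2: "x\<^sup>2 = 3 ^ a" by (simp add: x_def)
  have "3 * x \<le> x * x" using x by (intro mult_right_mono) auto
  also have "x * x = x ^ 2" by (simp add: power2_eq_square)
  also have "\<dots> \<le> x ^ b" using x ab by (intro power_increasing) auto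
  finally have xb: "3 * x \<le> x ^ b" .
  have "(x ^ b)\<^sup>2 = (x\<^sup>2) ^ b" by (simp add: mult.commute flip: power_mult)
  then have "(x ^ b)\<^sup>2 = 3 ^ k" by (simp add: x2 ab(1) power_mult)
  then have "(x ^ b - 1)\<^sup>2 \<le> eis_norm (\<theta> ^ k - 1)"
    using x xb by (intro theta_power_minus_one_bounds) auto
  also have "\<dots> \<le> (x + 1)\<^sup>2" unfolding N using x x2 by (intro theta_power_minus_one_bounds) auto
  finally have "x ^ b - 1 \<le> x + 1" using x by (elim power2_le_imp_le) simp
  then show False using x xb by simp
qed

section \<open>Even norm-perfect numbers\<close>

text \<open>Cleared of denominators, this compares the abundancy of \<open>p ^ e\<close> with that
  of \<open>x\<close>: the quotient of the two is the abundancy of the odd cofactor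
  \<open>y\<close>, which is at least 1 and equals 1 only for units.\<close>

lemma sigma_odd_split:
  assumes x: "x \<noteq> 0" "\<not> \<theta> dvd x" and p: "prime p" "p dvd x"
  obtains e y where "e > 0" "x = p ^ e * y"
    "eis_norm (eis_sigma (p ^ e)) * eis_norm x \<le> eis_norm (eis_sigma x) * eis_norm (p ^ e)"
    "eis_norm (eis_sigma (p ^ e)) * eis_norm x = eis_norm (eis_sigma x) * eis_norm (p ^ e) \<Longrightarrow> is_unit y"
proof -
  obtain e y where y: "e > 0" "x = p ^ e * y" "y \<noteq> 0" "\<not> p dvd y"
    "eis_sigma x = eis_sigma (p ^ e) * eis_sigma y"
    using prime_power_split[OF x(1) p] .
  have "\<not> \<theta> dvd y" using x(2) y(2) by auto
  note S = eis_norm_sigma_odd[OF y(3) this]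
  have pt: "p \<noteq> \<theta>" using p x by auto
  have q: "eis_norm (p ^ e) > 0" using p by (intro eis_norm_pos) auto
  have p4: "eis_norm p \<ge> 4" using odd_prime_norm_bounds[OF p(1) pt] by simp
  then have "0 < (eis_norm p + 2) * eis_norm (p ^ e)" using q by simp
  also have "\<dots> < eis_norm p * eis_norm (eis_sigma (p ^ e))"
    using sigma_odd_prime_power_gt[OF p(1) pt y(1)] .
  finally have s: "eis_norm (eis_sigma (p ^ e)) > 0" using p4 by (simp add: zero_less_mult_iff)
  define s q a b where d: "s = eis_norm (eis_sigma (p ^ e))" "q = eis_norm (p ^ e)"
    "a = eis_norm y" "b = eis_norm (eis_sigma y)"
  have N: "eis_norm x = q * a" "eis_norm (eis_sigma x) = s * b"
    by (simp_all only: d y(5) eis_norm_mult) (simp only: y(2) eis_norm_mult)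
  have pos: "s * q > 0" using s q by (simp add: d)
  then have "s * q \<noteq> 0" by linarith
  show ?thesis
  proof (rule that[OF y(1,2)])
    have "(s * q) * a \<le> (s * q) * b" using S pos by (intro mult_left_mono) (simp_all add: d)
    then show "eis_norm (eis_sigma (p ^ e)) * eis_norm x \<le> eis_norm (eis_sigma x) * eis_norm (p ^ e)"
      unfolding N d(1,2)[symmetric] by (simp add: algebra_simps)
    show "is_unit y"
      if "eis_norm (eis_sigma (p ^ e)) * eis_norm x = eis_norm (eis_sigma x) * eis_norm (p ^ e)"
    proof -
      have "(s * q) * a = (s * q) * b" using that unfolding N d(1,2)[symmetric] by (simp add: algebra_simps)
      then have "a = b" using \<open>s * q \<noteq> 0\<close> by (metis mult_left_cancel)
      then show ?thesis using S by (auto simp: d)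
    qed
  qed
qed

text \<open>An element divides its own norm, so the norm equation carries \<open>m\<close> into
  \<open>3 ^ k * (b * eis_cnj b)\<close>. Norms do not see conjugation, hence the two alternatives
  for \<open>p\<close>.\<close>

lemma prime_dvd_cofactor:
  assumes eq: "eis_norm (\<theta> ^ k - 1) * s = 3 ^ k * eis_norm b" and k: "k > 0"
    and m: "prime_elem m" "m dvd \<theta> ^ k - 1" and b: "\<not> \<theta> dvd b"
  obtains p where "prime p" "p dvd b" "p = normalize m \<or> p = normalize (eis_cnj m)"
proof -
  have "m dvd of_int (eis_norm (\<theta> ^ k - 1))"
    using m(2) unfolding eis_mult_cnj[symmetric] by (rule dvd_mult2)
  then have "m dvd of_int (eis_norm (\<theta> ^ k - 1)) * of_int s" by (rule dvd_mult2)
  also have "\<dots> = of_int 3 ^ k * of_int (eis_norm b)"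
    unfolding of_int_mult[symmetric] eq by simp
  also have "\<dots> = of_int 3 ^ k * (b * eis_cnj b)" unfolding eis_mult_cnj ..
  finally have "m dvd of_int 3 ^ k * (b * eis_cnj b)" .
  \<comment> \<open>Otherwise \<open>m\<close> divides 3, hence \<open>\<theta>\<^sup>2\<close> and
    \<open>\<theta> ^ k\<close>, and so also the difference 1.\<close>
  moreover have "\<not> m dvd of_int 3 ^ k"
  proof
    assume "m dvd of_int 3 ^ k"
    then have "m dvd of_int 3" using m(1) prime_elem_dvd_power by blast
    moreover have "of_int 3 dvd \<theta>\<^sup>2" by (simp add: theta_square)
    ultimately have "m dvd \<theta>" using m(1) prime_elem_dvd_power dvd_trans by blast
    then have "m dvd \<theta> ^ k" using k by (meson dvd_power dvd_trans)
    then have "m dvd \<theta> ^ k - (\<theta> ^ k - 1)" using m(2) by (rule dvd_diff)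
    then show False using m(1) by (simp add: prime_elem_def)
  qed
  ultimately have "m dvd b \<or> m dvd eis_cnj b" using m(1) by (simp add: prime_elem_dvd_mult_iff)
  then have "normalize m dvd b \<or> normalize (eis_cnj m) dvd b"
    using eis_cnj_dvd_iff[of m "eis_cnj b"] by auto
  moreover have "prime (normalize m)" "prime (normalize (eis_cnj m))" using m(1) by simp_all
  ultimately show ?thesis using that by blast
qed

text \<open>By \<open>eq\<close> the abundancy of \<open>b\<close> is \<open>3 ^ k\<close> over the
  norm of \<open>\<theta> ^ k - 1\<close>. It is at least that of the power of \<open>p\<close> in
  \<open>b\<close>, which exceeds 1 + 2/q for \<open>q\<close> the common norm of \<open>p\<close>
  and \<open>m\<close>.\<close>

lemma prime_dvd_theta_power_bound:
  assumes eq: "eis_norm (\<theta> ^ k - 1) * eis_norm (eis_sigma b) = 3 ^ k * eis_norm b" and k: "k > 0"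
    and m: "prime_elem m" "m dvd \<theta> ^ k - 1" and b: "b \<noteq> 0" "\<not> \<theta> dvd b"
  shows "eis_norm m * 3 ^ k > (eis_norm m + 2) * eis_norm (\<theta> ^ k - 1)"
proof -
  obtain p where p: "prime p" "p dvd b" "p = normalize m \<or> p = normalize (eis_cnj m)"
    using prime_dvd_cofactor[OF eq k m b(2)] .
  have q: "eis_norm p = eis_norm m" using p(3) by auto
  have pt: "p \<noteq> \<theta>" using p b by auto
  obtain e y where y: "e > 0" "b = p ^ e * y"
    "eis_norm (eis_sigma (p ^ e)) * eis_norm b \<le> eis_norm (eis_sigma b) * eis_norm (p ^ e)"
    using sigma_odd_split[OF b p(1,2)] by metis
  have pos: "eis_norm p > 0" "eis_norm (p ^ e) > 0" "eis_norm b > 0"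
    using p(1) b by (auto intro!: eis_norm_pos)
  define q N where d: "q = eis_norm p" "N = eis_norm (\<theta> ^ k - 1)"
  have Npos: "N > 0"
  proof -
    have "\<theta> ^ k \<noteq> 1"
      using prime_theta k by (metis dvd_power not_prime_unit)
    then show ?thesis unfolding d by (intro eis_norm_pos) simp
  qed
  have "((q + 2) * N) * (eis_norm (p ^ e) * eis_norm b) = N * ((q + 2) * eis_norm (p ^ e) * eis_norm b)"
    by simp
  also have "\<dots> < N * (q * eis_norm (eis_sigma (p ^ e)) * eis_norm b)"
    using sigma_odd_prime_power_gt[OF p(1) pt y(1)] Npos pos by (simp add: d)
  also have "\<dots> = (N * q) * (eis_norm (eis_sigma (p ^ e)) * eis_norm b)" by simp
  also have "\<dots> \<le> (N * q) * (eis_norm (eis_sigma b) * eis_norm (p ^ e))"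
    using y(3) Npos pos by (intro mult_left_mono) (auto simp: d)
  also have "\<dots> = q * eis_norm (p ^ e) * (N * eis_norm (eis_sigma b))" by simp
  also have "\<dots> = (q * 3 ^ k) * (eis_norm (p ^ e) * eis_norm b)" unfolding d(2) eq by simp
  finally have "(q + 2) * N < q * 3 ^ k" using pos by (simp add: mult_less_cancel_right)
  then show ?thesis by (simp add: d q \<open>eis_norm p = eis_norm m\<close>)
qed

section \<open>Inequalities for Mersenne norms and their conjugates\<close>

text \<open>Failure would mean \<open>2 * N < q * (3 * A - 1)\<close>; squaring and using
  \<open>q\<^sup>2 \<le> N\<close> gives \<open>4 * N < (3 * A - 1)\<^sup>2\<close>, but the left
  side is larger by \<open>3 * (A - 1)\<^sup>2\<close>.\<close>

lemma mersenne_prime_factor_arith: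
  fixes A q :: int
  assumes "q > 0" "A > 0" "q\<^sup>2 \<le> 3 * A\<^sup>2 - 3 * A + 1"
  shows "q * (3 * A\<^sup>2) \<le> (q + 2) * (3 * A\<^sup>2 - 3 * A + 1)"
proof (rule ccontr)
  define N where "N = 3 * A\<^sup>2 - 3 * A + 1"
  assume "\<not> ?thesis"
  then have less: "2 * N < q * (3 * A - 1)" by (simp add: N_def algebra_simps)
  have N: "N > 0" using assms(1,3) by (simp add: N_def) (smt (verit) zero_less_power)
  have "4 * N * N = (2 * N)\<^sup>2" by (simp add: power2_eq_square)
  also have "\<dots> < (q * (3 * A - 1))\<^sup>2" using less N by (intro power_strict_mono) auto
  also have "\<dots> = q\<^sup>2 * (3 * A - 1)\<^sup>2" by (rule power_mult_distrib)
  also have "\<dots> \<le> N * (3 * A - 1)\<^sup>2" using assms(3) by (intro mult_right_mono) (auto simp: N_def)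
  finally have "4 * N < (3 * A - 1)\<^sup>2" using N by (simp add: mult.commute)
  moreover have "4 * N - (3 * A - 1)\<^sup>2 = 3 * (A - 1)\<^sup>2"
    by (simp add: N_def power2_eq_square algebra_simps)
  ultimately show False using zero_le_power2[of "A - 1"] by linarith
qed

text \<open>This will exclude exponents above 1. Substituting
  \<open>3 * A\<^sup>2 = N + 3 * A - 1\<close> makes the difference of the sides
  \<open>6 * (A - 3) * A + 2\<close>.\<close>

lemma mersenne_prime_power_arith:
  fixes A N :: int
  assumes "A \<ge> 3" "N = 3 * A\<^sup>2 - 3 * A + 1"
  shows "12 * A\<^sup>2 * (N - 3 * A + 3) \<le> (4 * N - 2) * N"
proof -
  have "(4 * N - 2) * N - 4 * (N + 3 * A - 1) * (N - 3 * A + 3) = 36 * A\<^sup>2 - 48 * A + 12 - 10 * N"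
    by (simp add: power2_eq_square algebra_simps)
  also have "\<dots> = 6 * (A - 3) * A + 2" by (simp add: assms(2) power2_eq_square algebra_simps)
  also have "\<dots> \<ge> 0" using assms(1) by simp
  finally show ?thesis by (simp add: assms(2) algebra_simps)
qed

lemma normalize_cnj_mersenne:
  "normalize (eis_cnj (eis_mersenne j)) = of_int (2 * 3 ^ j - 1) + of_int (3 ^ j - 1) * \<omega>"
proof (rule eis_decomposition(1))
  \<comment> \<open>The fifth power is the inverse of the rotation in
    \<open>mersenne_cnj_associate\<close>.\<close>
  have "(1 + \<omega>) ^ 5 * (1 + \<omega>) = 1"
    using one_plus_omega_power_6 by (simp only: power_Suc2[symmetric]) simp
  then show "is_unit ((1 + \<omega>) ^ 5)" by (metis dvd_triv_left)
  show "eis_cnj (eis_mersenne j) =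
    (1 + \<omega>) ^ 5 * (of_int (2 * 3 ^ j - 1) + of_int (3 ^ j - 1) * \<omega>)"
    unfolding mersenne_cnj_associate[symmetric] mult.assoc[symmetric]
    by (simp only: \<open>(1 + \<omega>) ^ 5 * (1 + \<omega>) = 1\<close> mult_1)
  show "eis_positive (of_int (2 * 3 ^ j - 1) + of_int (3 ^ j - 1) * \<omega>)"
    unfolding eis_positive_coords by simp
qed

text \<open>The first norm is one more than \<open>3 * (3 ^ j)\<^sup>2\<close>; this single unit
  later excludes the conjugate as a divisor of the odd part.\<close>

lemma norm_normalize_cnj_mersenne:
  "eis_norm (normalize (eis_cnj (eis_mersenne j)) + 1) = 3 * (3 ^ j)\<^sup>2 + 1"
  "eis_norm (normalize (eis_cnj (eis_mersenne j)) - 1) \<le> eis_norm (eis_mersenne j) - 3 * 3 ^ j + 3"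
proof -
  have shift: "of_int a + b + 1 = of_int (a + 1) + b" "of_int a + b - 1 = of_int (a - 1) + b"
    for a and b :: eisenstein by simp_all
  show "eis_norm (normalize (eis_cnj (eis_mersenne j)) + 1) = 3 * (3 ^ j)\<^sup>2 + 1"
    "eis_norm (normalize (eis_cnj (eis_mersenne j)) - 1) \<le> eis_norm (eis_mersenne j) - 3 * 3 ^ j + 3"
    unfolding normalize_cnj_mersenne shift eis_norm_mersenne eis_norm_coords
    by (simp_all add: power2_eq_square algebra_simps)
qed

lemma theta_power_minus_one_cases:
  assumes "j mod 6 = 0 \<or> j mod 6 = 5"
  obtains "\<theta> ^ (2 * j + 1) - 1 = eis_mersenne j" | "\<theta> ^ (2 * j + 1) - 1 = eis_cnj (eis_mersenne j)"
  using assms theta_power_minus_one_mersenne[of j] by fast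

lemma prime_mersenne_iff:
  assumes "j mod 6 = 0 \<or> j mod 6 = 5" "j > 0"
  shows "prime_elem (\<theta> ^ (2 * j + 1) - 1) \<longleftrightarrow> prime (eis_mersenne j)"
  using assms(1)
  by (rule theta_power_minus_one_cases)
    (simp_all only: prime_iff_positive eis_positive_mersenne[OF assms(2)] prime_elem_eis_cnj simp_thms)

section \<open>Determining the even norm-perfect numbers\<close>

lemma even_norm_perfect_exponent_odd:
  assumes eq: "eis_norm (\<theta> ^ k - 1) * eis_norm (eis_sigma b) = 3 ^ k * eis_norm b" and k: "k \<ge> 2"
    and b: "b \<noteq> 0" "\<not> \<theta> dvd b"
  shows "odd k"
proof
  assume "even k"
  then obtain i where i: "k = 2 * i" by (elim evenE)
  \<comment> \<open>\<open>\<theta>\<^sup>2 - 1\<close> has norm 7, too small for a factor of \<open>\<theta> ^ k - 1\<close>\<close>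
  have "\<theta>\<^sup>2 - 1 = of_int 2 + of_int 3 * \<omega>" by (simp add: theta_square algebra_simps)
  then have N7: "eis_norm (\<theta>\<^sup>2 - 1) = 7" by (simp only: eis_norm_coords) simp
  have "\<theta>\<^sup>2 - 1 \<noteq> 0" using N7 eis_norm_eq_0_iff[of "\<theta>\<^sup>2 - 1"] by auto
  moreover have "\<not> is_unit (\<theta>\<^sup>2 - 1)" by (simp add: is_unit_iff_eis_norm N7)
  ultimately obtain m where m: "m dvd \<theta>\<^sup>2 - 1" "prime m" using prime_divisor_exists by blast
  have "prime (7::int)" by simp
  moreover have "eis_norm m dvd 7" using eis_norm_dvd[OF m(1)] N7 by simp
  moreover have "\<not> is_unit m" using m by auto
  ultimately have N: "eis_norm m = 7"
    using eis_norm_nonneg[of m] by (auto simp: prime_int_iff is_unit_iff_eis_norm)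
  have "\<theta>\<^sup>2 - 1 dvd (\<theta>\<^sup>2) ^ i - 1" by (metis dvd_triv_left power_diff_1_eq)
  then have "m dvd \<theta> ^ k - 1" using m(1) dvd_trans by (auto simp: i power_mult)
  then have "7 * 3 ^ k > (7 + 2) * eis_norm (\<theta> ^ k - 1)"
    using prime_dvd_theta_power_bound[OF eq _ _ _ b, of m] m(2) k unfolding N by simp
  then show False using eis_norm_theta_even_power[of i] k i by simp
qed

text \<open>If \<open>?M\<close> splits, the factor \<open>z\<close> of smaller norm satisfies
  \<open>(eis_norm z)\<^sup>2 \<le> eis_norm ?M\<close>, and so does any prime \<open>m\<close>
  below it. Then \<open>mersenne_prime_factor_arith\<close> contradicts
  \<open>prime_dvd_theta_power_bound\<close>.\<close>

lemma theta_power_minus_one_prime_if_norm_perfect: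
  assumes eq: "eis_norm (\<theta> ^ k - 1) * eis_norm (eis_sigma b) = 3 ^ k * eis_norm b"
    and k: "k = 2 * j + 1" and j: "j > 0"
    and N: "eis_norm (\<theta> ^ k - 1) = 3 * (3 ^ j)\<^sup>2 - 3 * 3 ^ j + 1"
    and b: "b \<noteq> 0" "\<not> \<theta> dvd b"
  shows "prime_elem (\<theta> ^ k - 1)"
proof (rule ccontr)
  let ?M = "\<theta> ^ k - 1"
  assume np: "\<not> prime_elem ?M"
  have gt: "eis_norm ?M > 1" using j k by (intro theta_power_minus_one_not_unit) auto
  then have "?M \<noteq> 0" using eis_norm_eq_0_iff[of ?M] by auto
  moreover have "\<not> is_unit ?M" using gt is_unit_iff_eis_norm[of ?M] by simp
  moreover have "\<not> irreducible ?M" using np irreducible_imp_prime_elem by blast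
  ultimately obtain x y where xy: "?M = x * y" "\<not> is_unit x" "\<not> is_unit y"
    by (auto simp: irreducible_def)
  have nz: "x \<noteq> 0" "y \<noteq> 0" using xy(1) \<open>?M \<noteq> 0\<close> by auto
  have Nxy: "eis_norm ?M = eis_norm x * eis_norm y" by (simp only: xy(1) eis_norm_mult)
  obtain z where z: "z dvd ?M" "\<not> is_unit z" "z \<noteq> 0" "(eis_norm z)\<^sup>2 \<le> eis_norm ?M"
  proof (cases "eis_norm x \<le> eis_norm y")
    case True
    then have "(eis_norm x)\<^sup>2 \<le> eis_norm ?M"
      unfolding Nxy power2_eq_square by (intro mult_left_mono eis_norm_nonneg)
    then show ?thesis using that[of x] xy nz by simp
  next
    case False
    then have "(eis_norm y)\<^sup>2 \<le> eis_norm ?M"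
      unfolding Nxy power2_eq_square by (intro mult_right_mono eis_norm_nonneg) simp
    then show ?thesis using that[of y] xy nz by simp
  qed
  obtain m where m: "m dvd z" "prime m" using z prime_divisor_exists by blast
  have pos: "eis_norm m > 0" using m(2) by (intro eis_norm_pos) auto
  have "eis_norm m \<le> eis_norm z"
    using eis_norm_dvd[OF m(1)] eis_norm_pos[OF z(3)] by (rule zdvd_imp_le)
  then have "(eis_norm m)\<^sup>2 \<le> (eis_norm z)\<^sup>2" using pos by (intro power_mono) auto
  then have "(eis_norm m)\<^sup>2 \<le> 3 * (3 ^ j)\<^sup>2 - 3 * 3 ^ j + 1" using z(4) N by simp
  then have "eis_norm m * (3 * (3 ^ j)\<^sup>2) \<le> (eis_norm m + 2) * eis_norm ?M"
    unfolding N using pos by (intro mersenne_prime_factor_arith) auto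
  moreover have "m dvd ?M" using m(1) z(1) by (rule dvd_trans)
  then have "eis_norm m * 3 ^ k > (eis_norm m + 2) * eis_norm ?M"
    using prime_dvd_theta_power_bound[OF eq _ _ _ b, of m] m(2) k by simp
  moreover have "(3::int) ^ k = 3 * (3 ^ j)\<^sup>2" by (simp add: k mult.commute flip: power_mult)
  ultimately show False by simp
qed

lemma even_norm_perfect_form:
  assumes ev: "\<theta> dvd \<alpha>" and perf: "eis_norm_perfect \<alpha>"
  obtains j u where "is_unit u" "j > 0" "j mod 6 = 0 \<or> j mod 6 = 5" "prime (eis_mersenne j)"
    "\<alpha> = u * \<theta> ^ (2 * j) * eis_mersenne j"
proof -
  have "\<alpha> \<noteq> 0" using perf by (simp add: eis_norm_perfect_def)
  then obtain n b where b: "n > 0" "\<alpha> = \<theta> ^ n * b" "b \<noteq> 0" "\<not> \<theta> dvd b"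
    "eis_sigma \<alpha> = eis_sigma (\<theta> ^ n) * eis_sigma b"
    using prime_power_split[OF _ prime_theta ev] by metis
  define k where "k = n + 1"
  have "eis_norm (eis_sigma \<alpha>) = 3 * eis_norm \<alpha>" using perf by (simp add: eis_norm_perfect_def)
  then have eq: "eis_norm (\<theta> ^ k - 1) * eis_norm (eis_sigma b) = 3 ^ k * eis_norm b"
    unfolding b(5) eis_norm_mult eis_norm_sigma_theta_power k_def
    by (simp add: b(2) eis_norm_mult eis_norm_power eis_norm_theta)
  have k2: "k \<ge> 2" using b(1) by (simp add: k_def)
  have "odd k" using eq k2 b(3,4) by (rule even_norm_perfect_exponent_odd)
  then obtain j where k: "k = 2 * j + 1" by (elim oddE)
  then have j: "j > 0" "n = 2 * j" using b(1) by (simp_all add: k_def)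
  define A :: int where "A = 3 ^ j"
  have A: "A \<ge> 3" unfolding A_def using power_increasing[of 1 j "3::int"] j(1) by simp
  have k3: "(3::int) ^ k = 3 * A\<^sup>2" by (simp add: k A_def mult.commute flip: power_mult)
  have bpos: "eis_norm b > 0" using b(3) by (rule eis_norm_pos)
  \<comment> \<open>The odd part has abundancy at least 1, so the norm of
    \<open>\<theta> ^ k - 1\<close> cannot exceed \<open>3 ^ k\<close>; this selects the residues of
    \<open>j\<close>.\<close>
  have "eis_norm (\<theta> ^ k - 1) * eis_norm b \<le> 3 ^ k * eis_norm b"
    unfolding eq[symmetric] using eis_norm_sigma_odd[OF b(3,4)] by (intro mult_left_mono eis_norm_nonneg) simp
  then have "eis_norm (\<theta> ^ k - 1) \<le> 3 ^ k" using bpos by simp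
  then have jmod: "j mod 6 = 0 \<or> j mod 6 = 5" unfolding k by (rule theta_odd_power_norm_le)
  then have M: "\<theta> ^ k - 1 = eis_mersenne j \<or> \<theta> ^ k - 1 = eis_cnj (eis_mersenne j)"
    unfolding k by (rule theta_power_minus_one_cases) simp_all
  define N where "N = eis_norm (eis_mersenne j)"
  have N: "N = 3 * A\<^sup>2 - 3 * A + 1" unfolding N_def A_def by (rule eis_norm_mersenne)
  have NM: "eis_norm (\<theta> ^ k - 1) = N" using M by (auto simp: N_def)
  have "prime_elem (\<theta> ^ k - 1)"
    using eq k j(1) NM[unfolded N A_def] b(3,4) by (rule theta_power_minus_one_prime_if_norm_perfect)
  note Mprime = this
  then have Pprime: "prime (eis_mersenne j)" unfolding k prime_mersenne_iff[OF jmod j(1)] .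
  obtain p where p: "prime p" "p dvd b"
    "p = normalize (\<theta> ^ k - 1) \<or> p = normalize (eis_cnj (\<theta> ^ k - 1))"
    using prime_dvd_cofactor[OF eq _ Mprime _ b(4)] k2 by auto
  have pcases: "p = eis_mersenne j \<or> p = normalize (eis_cnj (eis_mersenne j))"
    using p(3) M normalize_prime[OF Pprime] by (elim disjE) (simp_all only: eis_cnj_simps(6) simp_thms)
  then have Np: "eis_norm p = N" by (auto simp: N_def)
  have Np1: "eis_norm (p - 1) \<le> N - 3 * A + 3"
    using pcases norm_normalize_cnj_mersenne(2)[of j] eis_norm_mersenne(3)[of j]
    by (auto simp: N_def A_def)
  obtain e y where y: "e > 0" "b = p ^ e * y"
    "eis_norm (eis_sigma (p ^ e)) * eis_norm b \<le> eis_norm (eis_sigma b) * eis_norm (p ^ e)"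
    "eis_norm (eis_sigma (p ^ e)) * eis_norm b = eis_norm (eis_sigma b) * eis_norm (p ^ e) \<Longrightarrow> is_unit y"
    using sigma_odd_split[OF b(3,4) p(1,2)] by metis
  \<comment> \<open>The bound 16 is the square of the constant 4 fed to
    \<open>eis_norm_power_minus_one\<close> below.\<close>
  have "3 * 3 \<le> A * A" using A by (intro mult_mono) auto
  moreover have "3 * A \<le> A * A" using A by (intro mult_right_mono) auto
  ultimately have N16: "N \<ge> 16" unfolding N power2_eq_square by linarith
  define S where "S = eis_norm (eis_sigma (p ^ e))"
  \<comment> \<open>The abundancy of \<open>b\<close> is \<open>3 * A\<^sup>2 / N\<close> by
    \<open>eq\<close>, and it bounds that of \<open>p ^ e\<close>.\<close>
  have "(N * S) * eis_norm b \<le> N * (eis_norm (eis_sigma b) * N ^ e)"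
    using mult_left_mono[OF y(3), of N] N16 by (simp add: S_def eis_norm_power Np mult.assoc)
  also have "\<dots> = (3 * A\<^sup>2 * N ^ e) * eis_norm b"
    using eq unfolding NM k3 by (simp add: algebra_simps)
  finally have NS: "N * S \<le> 3 * A\<^sup>2 * N ^ e" using bpos by simp
  have "e = 1"
  proof (rule ccontr)
    assume "e \<noteq> 1"
    then have "real_of_int (4 * N * eis_norm (p ^ (e + 1) - 1)) > real_of_int ((4 * N - 2) * N ^ (e + 1))"
      using eis_norm_power_minus_one[of 4 p "e + 1"] y(1) N16 Np by simp
    then have "(4 * N - 2) * N ^ (e + 1) < 4 * N * eis_norm (p ^ (e + 1) - 1)"
      by (simp only: of_int_less_iff)
    also have "eis_norm (p ^ (e + 1) - 1) = S * eis_norm (p - 1)"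
      unfolding S_def eis_norm_mult[symmetric] eis_sigma_prime_power[OF p(1)] ..
    also have "4 * N * (S * eis_norm (p - 1)) = 4 * (N * S) * eis_norm (p - 1)" by simp
    also have "\<dots> \<le> 4 * (3 * A\<^sup>2 * N ^ e) * (N - 3 * A + 3)"
      using NS Np1 N16 by (intro mult_mono[OF mult_left_mono]) (auto simp: eis_norm_nonneg)
    finally have "((4 * N - 2) * N) * N ^ e < (12 * A\<^sup>2 * (N - 3 * A + 3)) * N ^ e"
      by (simp add: algebra_simps)
    then have "(4 * N - 2) * N < 12 * A\<^sup>2 * (N - 3 * A + 3)"
      using N16 by (simp add: mult_less_cancel_right)
    then show False using mersenne_prime_power_arith[OF A N] by simp
  qed
  note e = this
  have S: "S = eis_norm (p + 1)" by (simp add: S_def e eis_sigma_prime[OF p(1)])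
  \<comment> \<open>The conjugate candidate misses this bound by 1, so \<open>p\<close> is the
    Mersenne element itself.\<close>
  have "eis_norm (p + 1) \<le> 3 * A\<^sup>2" using NS N16 unfolding S e by (simp add: mult.commute)
  then have pP: "p = eis_mersenne j"
    using pcases norm_normalize_cnj_mersenne(1)[of j] by (auto simp: A_def)
  \<comment> \<open>Now \<open>p\<close> alone attains the abundancy of \<open>b\<close>: the
    equality case of \<open>sigma_odd_split\<close>.\<close>
  have "S = 3 * A\<^sup>2" unfolding S pP A_def by (rule eis_norm_mersenne)
  then have "S * eis_norm b = eis_norm (eis_sigma b) * eis_norm (p ^ e)"
    using eq unfolding NM k3 e by (simp add: Np mult.commute)
  then have "is_unit y" using y(4) by (simp add: S_def)
  then show ?thesis
    using that[OF _ j(1) jmod Pprime, of y] b(2) y(2) unfolding e pP j(2) by (simp add: mult_ac)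
qed

section \<open>Norm-perfection, primitivity and perfection of the Mersenne form\<close>

lemma theta_not_dvd_mersenne: "\<not> \<theta> dvd eis_mersenne j"
proof
  assume "\<theta> dvd eis_mersenne j"
  then have "\<theta> dvd of_int (3 ^ j) * \<theta> - eis_mersenne j" by (intro dvd_diff) auto
  then show False using prime_theta by (simp add: eis_mersenne_def)
qed

lemma sigma_mersenne_form:
  assumes "is_unit u" "prime (eis_mersenne j)"
  shows "eis_sigma (u * \<theta> ^ (2 * j) * eis_mersenne j) =
    eis_sigma (\<theta> ^ (2 * j)) * (eis_mersenne j + 1)"
proof -
  have "eis_mersenne j \<noteq> 0" using assms(2) by auto
  then show ?thesis
    using eis_sigma_unit_mult[OF assms(1)] theta_not_dvd_mersenne
      eis_sigma_prime_power_mult'[OF prime_theta, of "eis_mersenne j"] eis_sigma_prime[OF assms(2)]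
    by (simp add: mult.assoc)
qed

text \<open>Each factor \<open>p\<close> on the right divides \<open>y * w\<close>, hence the
  cofactor \<open>w\<close>, and can be cancelled.\<close>

lemma prime_elem_power_dvd_cancel:
  fixes p :: eisenstein
  assumes "prime_elem p" "\<not> p dvd y" "y dvd p ^ n * z"
  shows "y dvd z"
  using assms(3)
proof (induction n)
  case (Suc n)
  then obtain w where w: "p * (p ^ n * z) = y * w" by (auto simp: mult.assoc elim: dvdE)
  then have "p dvd y * w" by (metis dvd_triv_left)
  then obtain v where "w = p * v" using assms(1,2) by (auto simp: prime_elem_dvd_mult_iff elim: dvdE)
  then have "p ^ n * z = y * v" using w assms(1) by (auto simp: mult.left_commute)
  then show ?case using Suc.IH by simp
qed simp

context
  fixes j :: nat and u :: eisenstein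
  assumes u: "is_unit u" and j: "j > 0" "j mod 6 = 0 \<or> j mod 6 = 5"
    and P: "prime (eis_mersenne j)"
begin

text \<open>The two prime powers exchange norms: the divisor sum of
  \<open>\<theta> ^ (2 * j)\<close> has the norm of the Mersenne prime, whose own divisor sum has
  norm \<open>3 ^ (2 * j + 1)\<close>.\<close>

lemma mersenne_form_norm_perfect: "eis_norm_perfect (u * \<theta> ^ (2 * j) * eis_mersenne j)"
proof -
  let ?\<alpha> = "u * \<theta> ^ (2 * j) * eis_mersenne j"
  have "?\<alpha> \<noteq> 0" using u P prime_theta by auto
  have "eis_norm (\<theta> ^ (2 * j + 1) - 1) = eis_norm (eis_mersenne j)"
    using j(2) by (rule theta_power_minus_one_cases) simp_all
  then have "eis_norm (eis_sigma ?\<alpha>) = eis_norm (eis_mersenne j) * (3 * (3 ^ j)\<^sup>2)"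
    unfolding sigma_mersenne_form[OF u P] eis_norm_mult eis_norm_sigma_theta_power eis_norm_mersenne(2)
    by simp
  also have "\<dots> = 3 * eis_norm ?\<alpha>"
    using u unfolding is_unit_iff_eis_norm
    by (simp add: eis_norm_mult eis_norm_power eis_norm_theta mult.commute flip: power_mult)
  finally show ?thesis using \<open>?\<alpha> \<noteq> 0\<close> by (simp add: eis_norm_perfect_def)
qed

text \<open>An even divisor falls under the classification with some index \<open>i\<close>, and
  divisibility of the Mersenne primes forces \<open>i = j\<close>. An odd divisor is a unit or an
  associate of the Mersenne prime, and neither is norm-perfect.\<close>

lemma norm_perfect_dvd_mersenne_form:
  assumes y: "eis_norm_perfect y" "y dvd u * \<theta> ^ (2 * j) * eis_mersenne j"
  shows "eis_associated y (u * \<theta> ^ (2 * j) * eis_mersenne j)"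
proof (cases "\<theta> dvd y")
  case True
  then obtain i v where i: "is_unit v" "prime (eis_mersenne i)" "y = v * \<theta> ^ (2 * i) * eis_mersenne i"
    using even_norm_perfect_form y(1) by metis
  have "\<not> eis_mersenne i dvd \<theta>"
    using primes_dvd_imp_eq[OF i(2) prime_theta] theta_not_dvd_mersenne[of i] by auto
  then have "\<not> eis_mersenne i dvd \<theta> ^ (2 * j)" using i(2) prime_dvd_power by blast
  moreover have "\<not> eis_mersenne i dvd u" using i(2) u dvd_trans not_prime_unit by blast
  moreover have "eis_mersenne i dvd u * \<theta> ^ (2 * j) * eis_mersenne j"
    using y(2) unfolding i(3) by (rule dvd_mult_right)
  ultimately have "eis_mersenne i dvd eis_mersenne j" using i(2) by (simp add: prime_dvd_mult_iff)
  then have "eis_mersenne i = eis_mersenne j" using primes_dvd_imp_eq i(2) P by blast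
  then have "i = j" unfolding eis_mersenne_coords eis_coords_unique by simp
  obtain w where w: "1 = u * w" using u by (elim dvdE)
  then have "is_unit (v * w)" using i(1) by (metis dvd_triv_right is_unit_mult_iff)
  moreover have "y = (u * w) * (v * \<theta> ^ (2 * j) * eis_mersenne j)" unfolding w[symmetric] by (simp add: i(3) \<open>i = j\<close>)
  then have "y = v * w * (u * \<theta> ^ (2 * j) * eis_mersenne j)" by (simp add: mult_ac)
  ultimately show ?thesis unfolding eis_associated_def by blast
next
  case False
  have "y dvd \<theta> ^ (2 * j) * (u * eis_mersenne j)" using y(2) by (simp add: mult_ac)
  then have "y dvd u * eis_mersenne j"
    using prime_elem_power_dvd_cancel[OF _ False] prime_theta by blast
  then have "y dvd eis_mersenne j" using u by (simp add: dvd_mult_unit_iff')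
  then obtain c where c: "eis_mersenne j = y * c" by (elim dvdE)
  have "irreducible (eis_mersenne j)" using P by (simp add: prime_elem_imp_irreducible)
  then have "is_unit y \<or> is_unit c" using c by (rule irreducibleD)
  then have False
  proof
    assume "is_unit y"
    then show False
      using y(1) by (simp add: eis_norm_perfect_def eis_sigma_is_unit eis_norm_1 is_unit_iff_eis_norm)
  next
    assume unit: "is_unit c"
    then have "eis_norm y = eis_norm (eis_mersenne j)"
      by (simp add: c eis_norm_mult is_unit_iff_eis_norm)
    moreover have "eis_sigma (eis_mersenne j) = eis_sigma y"
      unfolding c using eis_sigma_unit_mult[OF unit, of y] by (simp add: mult.commute)
    then have "eis_norm (eis_sigma y) = 3 * (3 ^ j)\<^sup>2"
      using eis_norm_mersenne(2)[of j] eis_sigma_prime[OF P] by simp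
    ultimately have "3 * (3 ^ j)\<^sup>2 = 3 * (3 * (3 ^ j)\<^sup>2 - 3 * 3 ^ j + 1 :: int)"
      using y(1) by (simp only: eis_norm_perfect_def eis_norm_mersenne(1))
    \<comment> \<open>With \<open>A = 3 ^ j\<close>, the equation is
      \<open>2 * A\<^sup>2 - 3 * A + 1 = 0\<close>, which factors.\<close>
    then have "(2 * 3 ^ j - 1) * (3 ^ j - 1) = (0::int)" by (simp add: power2_eq_square algebra_simps)
    moreover have "(3::int) ^ j > 1" using j(1) by simp
    ultimately show False by simp
  qed
  then show ?thesis ..
qed

text \<open>For residue 0, \<open>\<theta> ^ (2 * j + 1)\<close> equals \<open>?P + 1\<close>, so
  perfection compares two units. For residue 5, perfection would make \<open>?P\<close> divide its
  conjugate, being coprime to \<open>?P + 1\<close>.\<close>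

lemma mersenne_form_perfect_iff:
  "eis_perfect (u * \<theta> ^ (2 * j) * eis_mersenne j) \<longleftrightarrow> j mod 6 = 0 \<and> u = - \<omega>"
proof -
  let ?P = "eis_mersenne j" and ?\<alpha> = "u * \<theta> ^ (2 * j) * eis_mersenne j"
  have P0: "?P \<noteq> 0" and t0: "\<theta> \<noteq> 0" using P prime_theta by auto
  then have nz: "?\<alpha> \<noteq> 0" using u by auto
  \<comment> \<open>Inserting \<open>1 = - \<omega> * (\<theta> - 1)\<close> supplies the
    denominator of the geometric sum.\<close>
  have "eis_sigma (\<theta> ^ (2 * j)) = eis_sigma (\<theta> ^ (2 * j)) * (- \<omega> * (\<theta> - 1))"
    unfolding theta_minus_one(1) by simp
  also have "\<dots> = - \<omega> * (eis_sigma (\<theta> ^ (2 * j)) * (\<theta> - 1))" by (simp only: mult_ac)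
  also have "\<dots> = - \<omega> * (\<theta> ^ (2 * j + 1) - 1)"
    unfolding eis_sigma_prime_power[OF prime_theta] ..
  finally have S: "eis_sigma ?\<alpha> = - \<omega> * (\<theta> ^ (2 * j + 1) - 1) * (?P + 1)"
    unfolding sigma_mersenne_form[OF u P] by simp
  have T: "\<theta> * ?\<alpha> = u * \<theta> ^ (2 * j + 1) * ?P" by (simp add: mult_ac)
  show ?thesis
  proof (cases "j mod 6 = 0")
    case True
    have M: "\<theta> ^ (2 * j + 1) - 1 = ?P" by (rule theta_power_minus_one_mersenne(1)[OF True])
    then have "?P + 1 = \<theta> ^ (2 * j + 1)" by (metis diff_add_cancel)
    then have "eis_sigma ?\<alpha> = - \<omega> * (\<theta> ^ (2 * j + 1) * ?P)" unfolding S M by (simp only: mult_ac)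
    moreover have "\<theta> * ?\<alpha> = u * (\<theta> ^ (2 * j + 1) * ?P)" unfolding T by (simp only: mult_ac)
    moreover have "\<theta> ^ (2 * j + 1) * ?P \<noteq> 0" using P0 t0 by simp
    ultimately have "eis_sigma ?\<alpha> = \<theta> * ?\<alpha> \<longleftrightarrow> - \<omega> = u" by (metis mult_right_cancel)
    then show ?thesis using True nz unfolding eis_perfect_def one_minus_omega_square by auto
  next
    case False
    then have M: "\<theta> ^ (2 * j + 1) - 1 = eis_cnj ?P"
      using j(2) by (intro theta_power_minus_one_mersenne(2)) simp
    have "\<not> eis_perfect ?\<alpha>"
    proof
      assume "eis_perfect ?\<alpha>"
      then have eq: "- \<omega> * eis_cnj ?P * (?P + 1) = u * \<theta> ^ (2 * j + 1) * ?P"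
        using S T unfolding eis_perfect_def one_minus_omega_square M by simp
      then have "?P dvd - \<omega> * eis_cnj ?P * (?P + 1)" by (metis dvd_triv_right)
      moreover have "\<not> ?P dvd ?P + 1" using P by (simp add: dvd_add_right_iff)
      moreover have "\<not> ?P dvd - \<omega>"
        using P eis_units(2) dvd_trans not_prime_unit by (metis dvd_minus_iff)
      ultimately have "?P dvd eis_cnj ?P" using P by (metis prime_dvd_mult_iff)
      then have "?P dvd normalize (eis_cnj ?P)" by simp
      moreover have "prime (normalize (eis_cnj ?P))" using P by simp
      ultimately have "?P = normalize (eis_cnj ?P)" using P primes_dvd_imp_eq by blast
      \<comment> \<open>The second coordinates are \<open>3 ^ j\<close> and
        \<open>3 ^ j - 1\<close>.\<close>
      then show False unfolding normalize_cnj_mersenne unfolding eis_mersenne_coords eis_coords_unique by simp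
    qed
    then show ?thesis using False by simp
  qed
qed

end

section \<open>Both classifications, and the passage to rational prime exponents\<close>

lemma eis_perfect_imp_norm_perfect: "eis_perfect x \<Longrightarrow> eis_norm_perfect x"
  by (simp add: eis_perfect_def eis_norm_perfect_def one_minus_omega_square eis_norm_mult eis_norm_theta)

lemma even_primitive_norm_perfect_iff:
  "eis_even \<alpha> \<and> primitive_for eis_norm_perfect \<alpha> \<longleftrightarrow>
    (\<exists>j u. is_unit u \<and> j > 0 \<and> (j mod 6 = 0 \<or> j mod 6 = 5) \<and> prime (eis_mersenne j) \<and>
      \<alpha> = u * \<theta> ^ (2 * j) * eis_mersenne j)" (is "?L \<longleftrightarrow> ?R")
proof
  assume ?L
  then have "\<theta> dvd \<alpha>" "eis_norm_perfect \<alpha>"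
    by (simp_all add: eis_even_def one_minus_omega_square primitive_for_def)
  then show ?R using even_norm_perfect_form by metis
next
  assume ?R
  then obtain j u where ju: "is_unit u" "j > 0" "j mod 6 = 0 \<or> j mod 6 = 5" "prime (eis_mersenne j)"
    and \<alpha>: "\<alpha> = u * \<theta> ^ (2 * j) * eis_mersenne j" by (elim exE conjE)
  have "\<theta> dvd \<alpha>" unfolding \<alpha> using ju(2) by (simp add: dvd_power)
  then show ?L
    using mersenne_form_norm_perfect[OF ju] norm_perfect_dvd_mersenne_form[OF ju]
    unfolding eis_even_def primitive_for_def one_minus_omega_square \<alpha> by blast
qed

lemma even_primitive_perfect_iff:
  "eis_even \<alpha> \<and> primitive_for eis_perfect \<alpha> \<longleftrightarrow>
    (\<exists>j. j > 0 \<and> j mod 6 = 0 \<and> prime (eis_mersenne j) \<and> \<alpha> = - \<omega> * \<theta> ^ (2 * j) * eis_mersenne j)"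
  (is "?L \<longleftrightarrow> ?R")
proof
  assume L: ?L
  then have perf: "eis_perfect \<alpha>" by (simp add: primitive_for_def)
  then have "eis_norm_perfect \<alpha>" by (rule eis_perfect_imp_norm_perfect)
  moreover have "\<theta> dvd \<alpha>" using L by (simp add: eis_even_def one_minus_omega_square)
  ultimately obtain j u where ju: "is_unit u" "j > 0" "j mod 6 = 0 \<or> j mod 6 = 5" "prime (eis_mersenne j)"
    and \<alpha>: "\<alpha> = u * \<theta> ^ (2 * j) * eis_mersenne j"
    using even_norm_perfect_form by metis
  then show ?R using perf mersenne_form_perfect_iff[OF ju] by auto
next
  assume ?R
  then obtain j where j0: "j > 0" "j mod 6 = 0" "prime (eis_mersenne j)"
    and \<alpha>: "\<alpha> = - \<omega> * \<theta> ^ (2 * j) * eis_mersenne j" by (elim exE conjE)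
  have j: "j > 0" "j mod 6 = 0 \<or> j mod 6 = 5" "prime (eis_mersenne j)" "j mod 6 = 0"
    using j0 by simp_all
  have unit: "is_unit (- \<omega>)" using eis_units(2) by simp
  have "eis_perfect \<alpha>" using mersenne_form_perfect_iff[OF unit j(1-3)] j(4) \<alpha> by simp
  \<comment> \<open>A perfect divisor is norm-perfect, so primitivity carries over from norm-perfect
    to perfect.\<close>
  moreover have "eis_even \<alpha> \<and> primitive_for eis_norm_perfect \<alpha>"
    unfolding even_primitive_norm_perfect_iff using unit j \<alpha>
    by (intro exI[of _ j] exI[of _ "- \<omega>"] conjI)
  ultimately show ?L unfolding primitive_for_def using eis_perfect_imp_norm_perfect by blast
qed

text \<open>The substitution \<open>k = 2 * j + 1\<close> turns residues modulo 12 into residues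
  modulo 6; from right to left, primality of \<open>k\<close> comes from that of
  \<open>\<theta> ^ k - 1\<close>. The predicate \<open>Q\<close> stands for the equation for
  \<open>\<alpha>\<close>, with or without a quantified unit.\<close>

lemma mersenne_exponent_iff:
  "(\<exists>k. prime k \<and> [int k = 1] (mod 12) \<and> prime_elem (\<theta> ^ k - 1) \<and> Q (k - 1) (\<theta> ^ k - 1)) \<longleftrightarrow>
    (\<exists>j. j > 0 \<and> j mod 6 = 0 \<and> prime (eis_mersenne j) \<and> Q (2 * j) (eis_mersenne j))"
  "(\<exists>k. prime k \<and> [int k = - 1] (mod 12) \<and> prime_elem (\<theta> ^ k - 1) \<and> Q (k - 1) (eis_cnj (\<theta> ^ k - 1))) \<longleftrightarrow>
    (\<exists>j. j > 0 \<and> j mod 6 = 5 \<and> prime (eis_mersenne j) \<and> Q (2 * j) (eis_mersenne j))"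
proof -
  have main: "(\<exists>k. prime k \<and> [int k = c] (mod 12) \<and> prime_elem (\<theta> ^ k - 1) \<and> R (k - 1) (\<theta> ^ k - 1)) \<longleftrightarrow>
      (\<exists>j. j > 0 \<and> j mod 6 = d \<and> prime (eis_mersenne j) \<and> R (2 * j) (\<theta> ^ (2 * j + 1) - 1))"
    if cd: "c = 1 \<and> d = 0 \<or> c = - 1 \<and> d = 5" for c :: int and d :: nat and R
  proof (intro iffI; elim exE conjE)
    fix k assume k: "prime k" "[int k = c] (mod 12)" "prime_elem (\<theta> ^ k - 1)" "R (k - 1) (\<theta> ^ k - 1)"
    define j m where "j = (k - 1) div 2" "m = k div 12"
    have "k \<ge> 2" using k(1) by (rule prime_ge_2_nat)
    have "int (k mod 12) = c mod 12" using k(2) by (simp add: cong_def zmod_int)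
    then have "k mod 12 = 1 \<and> d = 0 \<or> k mod 12 = 11 \<and> d = 5" using cd by auto
    moreover have "k = 12 * m + k mod 12" by (simp add: j_m_def)
    ultimately have "k = 12 * m + 1 \<and> d = 0 \<or> k = 12 * m + 11 \<and> d = 5" by auto
    then have "k = 2 * j + 1 \<and> j > 0 \<and> j mod 6 = d"
    proof (elim disjE conjE)
      \<comment> \<open>Only here is \<open>k \<ge> 2\<close> needed for \<open>j > 0\<close>: it
        excludes \<open>m = 0\<close>.\<close>
      assume "k = 12 * m + 1" "d = 0"
      moreover from this have "j = 6 * m" by (simp add: j_m_def(1))
      ultimately show ?thesis using \<open>k \<ge> 2\<close> by simp
    next
      assume "k = 12 * m + 11" "d = 5"
      moreover from this have "j = 6 * m + 5" by (simp add: j_m_def(1))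
      ultimately show ?thesis by simp
    qed
    then have j: "k = 2 * j + 1" "j > 0" "j mod 6 = d" by simp_all
    have "prime (eis_mersenne j)" using k(3) prime_mersenne_iff[of j] j cd by auto
    then show "\<exists>j. j > 0 \<and> j mod 6 = d \<and> prime (eis_mersenne j) \<and> R (2 * j) (\<theta> ^ (2 * j + 1) - 1)"
      using j k(4) by (intro exI[of _ j]) simp
  next
    fix j assume j: "j > 0" "j mod 6 = d" "prime (eis_mersenne j)" "R (2 * j) (\<theta> ^ (2 * j + 1) - 1)"
    have pr: "prime_elem (\<theta> ^ (2 * j + 1) - 1)" using j prime_mersenne_iff[of j] cd by auto
    then have "prime (2 * j + 1)" using j(1) by (intro theta_power_minus_one_prime_imp_prime) auto
    moreover have "[int (2 * j + 1) = c] (mod 12)"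
    proof -
      obtain m where "j = 6 * m + d" using j(2) mult_div_mod_eq by metis
      \<comment> \<open>The extra 1 for \<open>d = 5\<close> arises from
        \<open>2 * 5 + 1 - (- 1) = 12\<close>.\<close>
      then have "int (2 * j + 1) - c = 12 * (int m + (if d = 0 then 0 else 1))" using cd by auto
      then show ?thesis by (metis cong_iff_dvd_diff dvd_triv_left)
    qed
    ultimately show "\<exists>k. prime k \<and> [int k = c] (mod 12) \<and> prime_elem (\<theta> ^ k - 1) \<and> R (k - 1) (\<theta> ^ k - 1)"
      using pr j(4) by (intro exI[of _ "2 * j + 1"] conjI) (simp_all only: add_diff_cancel_right')
  qed
  show "(\<exists>k. prime k \<and> [int k = 1] (mod 12) \<and> prime_elem (\<theta> ^ k - 1) \<and> Q (k - 1) (\<theta> ^ k - 1)) \<longleftrightarrow>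
    (\<exists>j. j > 0 \<and> j mod 6 = 0 \<and> prime (eis_mersenne j) \<and> Q (2 * j) (eis_mersenne j))"
    by (rule trans[OF main[of 1 0 Q, OF disjI1[OF conjI[OF refl refl]]]],
        intro ex_cong1 conj_cong refl) (simp only: theta_power_minus_one_mersenne(1))
  show "(\<exists>k. prime k \<and> [int k = - 1] (mod 12) \<and> prime_elem (\<theta> ^ k - 1) \<and> Q (k - 1) (eis_cnj (\<theta> ^ k - 1))) \<longleftrightarrow>
    (\<exists>j. j > 0 \<and> j mod 6 = 5 \<and> prime (eis_mersenne j) \<and> Q (2 * j) (eis_mersenne j))"
    by (rule trans[OF main[of "- 1" 5 "\<lambda>n x. Q n (eis_cnj x)", OF disjI2[OF conjI[OF refl refl]]]],
        intro ex_cong1 conj_cong refl) (simp only: theta_power_minus_one_mersenne(2) eis_cnj_simps(6))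
qed

theorem mainTheorem1:
  shows "(\<forall>\<alpha>. eis_even \<alpha> \<and> primitive_for eis_norm_perfect \<alpha> \<longleftrightarrow>
      (\<exists>(k::nat) \<epsilon>. is_unit \<epsilon> \<and> prime k \<and> [int k = 1] (mod 12) \<and> prime_elem ((1 - \<omega>^2)^k - 1) \<and>
          \<alpha> = \<epsilon> * (1 - \<omega>^2)^(k - 1) * ((1 - \<omega>^2)^k - 1)) \<or>
      (\<exists>(k::nat) \<epsilon>. is_unit \<epsilon> \<and> prime k \<and> [int k = - 1] (mod 12) \<and> prime_elem ((1 - \<omega>^2)^k - 1) \<and>
          \<alpha> = \<epsilon> * (1 - \<omega>^2)^(k - 1) * eis_cnj ((1 - \<omega>^2)^k - 1))) \<and>
    (\<forall>\<alpha>. eis_even \<alpha> \<and> primitive_for eis_perfect \<alpha> \<longleftrightarrow>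
      (\<exists>k::nat. prime k \<and> [int k = 1] (mod 12) \<and> prime_elem ((1 - \<omega>^2)^k - 1) \<and>
          \<alpha> = - \<omega> * (1 - \<omega>^2)^(k - 1) * ((1 - \<omega>^2)^k - 1)))"
proof -
  have "eis_even \<alpha> \<and> primitive_for eis_norm_perfect \<alpha> \<longleftrightarrow>
      (\<exists>k \<epsilon>. is_unit \<epsilon> \<and> prime k \<and> [int k = 1] (mod 12) \<and> prime_elem (\<theta> ^ k - 1) \<and>
          \<alpha> = \<epsilon> * \<theta> ^ (k - 1) * (\<theta> ^ k - 1)) \<or>
      (\<exists>k \<epsilon>. is_unit \<epsilon> \<and> prime k \<and> [int k = - 1] (mod 12) \<and> prime_elem (\<theta> ^ k - 1) \<and>
          \<alpha> = \<epsilon> * \<theta> ^ (k - 1) * eis_cnj (\<theta> ^ k - 1))" for \<alpha>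
  proof -
    have split: "(\<exists>j u. U u \<and> X j \<and> (Y j \<or> Z j) \<and> W j \<and> R j u) \<longleftrightarrow>
        (\<exists>j. X j \<and> Y j \<and> W j \<and> (\<exists>u. U u \<and> R j u)) \<or>
        (\<exists>j. X j \<and> Z j \<and> W j \<and> (\<exists>u. U u \<and> R j u))"
      for U :: "eisenstein \<Rightarrow> bool" and X Y Z W :: "nat \<Rightarrow> bool" and R by blast
    have pull: "(\<exists>k. X k \<and> Y k \<and> Z k \<and> (\<exists>u. U u \<and> R k u)) \<longleftrightarrow>
        (\<exists>k u. U u \<and> X k \<and> Y k \<and> Z k \<and> R k u)"
      for U :: "eisenstein \<Rightarrow> bool" and X Y Z :: "nat \<Rightarrow> bool" and R by blast
    \<comment> \<open>Naming the equation gives it the shape of \<open>Q\<close>, with the unit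
      quantified inside.\<close>
    define R where "R n x \<epsilon> \<longleftrightarrow> \<alpha> = \<epsilon> * \<theta> ^ n * x" for n x \<epsilon>
    have "eis_even \<alpha> \<and> primitive_for eis_norm_perfect \<alpha> \<longleftrightarrow>
        (\<exists>j u. is_unit u \<and> j > 0 \<and> (j mod 6 = 0 \<or> j mod 6 = 5) \<and> prime (eis_mersenne j) \<and>
          R (2 * j) (eis_mersenne j) u)"
      unfolding even_primitive_norm_perfect_iff R_def ..
    also have "\<dots> \<longleftrightarrow>
        (\<exists>j. j > 0 \<and> j mod 6 = 0 \<and> prime (eis_mersenne j) \<and>
          (\<exists>\<epsilon>. is_unit \<epsilon> \<and> R (2 * j) (eis_mersenne j) \<epsilon>)) \<or>
        (\<exists>j. j > 0 \<and> j mod 6 = 5 \<and> prime (eis_mersenne j) \<and>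
          (\<exists>\<epsilon>. is_unit \<epsilon> \<and> R (2 * j) (eis_mersenne j) \<epsilon>))"
      by (rule split)
    also have "\<dots> \<longleftrightarrow>
        (\<exists>k. prime k \<and> [int k = 1] (mod 12) \<and> prime_elem (\<theta> ^ k - 1) \<and>
          (\<exists>\<epsilon>. is_unit \<epsilon> \<and> R (k - 1) (\<theta> ^ k - 1) \<epsilon>)) \<or>
        (\<exists>k. prime k \<and> [int k = - 1] (mod 12) \<and> prime_elem (\<theta> ^ k - 1) \<and>
          (\<exists>\<epsilon>. is_unit \<epsilon> \<and> R (k - 1) (eis_cnj (\<theta> ^ k - 1)) \<epsilon>))"
      unfolding mersenne_exponent_iff[of "\<lambda>n x. \<exists>\<epsilon>. is_unit \<epsilon> \<and> R n x \<epsilon>"] ..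
    finally show ?thesis unfolding pull R_def .
  qed
  moreover have "eis_even \<alpha> \<and> primitive_for eis_perfect \<alpha> \<longleftrightarrow>
      (\<exists>k. prime k \<and> [int k = 1] (mod 12) \<and> prime_elem (\<theta> ^ k - 1) \<and>
          \<alpha> = - \<omega> * \<theta> ^ (k - 1) * (\<theta> ^ k - 1))" for \<alpha>
    unfolding even_primitive_perfect_iff
    by (rule mersenne_exponent_iff(1)[of "\<lambda>n x. \<alpha> = - \<omega> * \<theta> ^ n * x", symmetric])
  ultimately show ?thesis unfolding one_minus_omega_square by (intro conjI allI)
qed

end
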